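(* Let $(g,f)$ be a homogeneous pair of degree $\alpha\in\mathbb{R}-\{0\}$ on a manifold $M$ with a free $\mathbb{R}_{>0}$-action. Suppose that $\dim M=2$. Then, given $C\in\mathbb{R}$, the metric $(v\circ f)g$ has constant sectional curvature $C$ if $$v(r)=\frac1r\,w\left(\frac C\alpha,C_1,C_2,r\right),$$ where $C_1,C_2\in\mathbb{R}$ are such that $\left(\frac C\alpha,C_1,C_2\right)\in\Delta_1\cup\Delta_2\cup\Delta_3$. In particular (setting $C=0$), $f^\beta g$ is flat for any $\beta\in\mathbb{R}$.
   Context: Homogeneous pair: $m:\mathbb{R}_{>0}\times M\to M$ is a smooth free action, $m_\lambda=m(\lambda,\cdot)$, $P_x=\frac{d}{dt}m(e^t,x)|_{t=0}$. For a pseudo-Riemannian metric $g$, a smooth $f:M\to\mathbb{R}_{>0}$ and $\alpha\in\mathbb{R}-\{0\}$, $(g,f)$ is a homogeneous pair of degree $\alpha$ if $m_\lambda^*g=\lambda^\alpha g$, $m_\lambda^*f=\lambda^\alpha f$ for all $\lambda>0$ and $g(P,\cdot)=df$. The function $w$: set $\Delta_1=\{(s,C_1,C_2)\in\mathbb{R}^3\mid s>0,\ C_1>0\}$, $\Delta_2=\{(s,C_1,C_2)\in\mathbb{R}^3\mid s=0,\ C_1\ge0\}$, $\Delta_3=\{(s,C_1,C_2)\in\mathbb{R}^3\mid s<0,\ C_1\le0\}$. For (generic) $r\in\mathbb{R}_{>0}$ define - for $(s,C_1,C_2)\in\Delta_1$: $w(s,C_1,C_2,r)=\dfrac{C_1}{s\cosh^2(\sqrt{C_1}(\log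 r+C_2))}$; - for $(0,C_1,C_2)\in\Delta_2$: $w(0,C_1,C_2,r)=e^{C_2}r^{\pm2\sqrt{C_1}}$ (either choice of sign is allowed); - for $(s,C_1,C_2)\in\Delta_3$ with $C_1<0$: $w(s,C_1,C_2,r)=\dfrac{C_1}{s\sin^2(\sqrt{-C_1}(\log r+C_2))}$; - for $(s,0,C_2)\in\Delta_3$: $w(s,0,C_2,r)=\dfrac{-1}{s(\log r+C_2)^2}$. When $\alpha C\ge0$, $v$ is defined for all $r>0$; when $\alpha C<0$, $v$ is only defined on the complement of a discrete subset of $\mathbb{R}_{>0}$, and $(v\circ f)g$ is considered on the open subset of $M$ where $v\circ f$ is defined. *)

theory Defs
  imports "HOL-Analysis.Analysis"
begin

section \<open>Smooth maps between open subsets of normed spaces\<close>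

text \<open>Meant for open \<open>S\<close> in a finite-dimensional space, where requiring all directional derivatives
  to be of class \<open>C\<^sup>k\<close> is the usual notion.\<close>

primrec Ck_on ::
  "nat \<Rightarrow> 'a::real_normed_vector set \<Rightarrow> ('a \<Rightarrow> 'b::real_normed_vector) \<Rightarrow> bool" where
  "Ck_on 0 S h \<longleftrightarrow> continuous_on S h"
| "Ck_on (Suc k) S h \<longleftrightarrow>
     (\<forall>x\<in>S. h differentiable (at x)) \<and> (\<forall>v. Ck_on k S (\<lambda>x. frechet_derivative h (at x) v))"

definition smooth_on :: "'a::real_normed_vector set \<Rightarrow> ('a \<Rightarrow> 'b::real_normed_vector) \<Rightarrow> bool" where
  "smooth_on S h \<longleftrightarrow> (\<forall>k. Ck_on k S h)"


section \<open>Smooth manifolds\<close>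

text \<open>The manifold is the whole type \<open>'a\<close>, whose topology is required to be Hausdorff and second
  countable by the type classes in \<open>smooth_atlas\<close>; its dimension is \<open>CARD('n)\<close>.\<close>

datatype ('a, 'n) chart = Chart (chart_dom: "'a set") (chart_map: "'a \<Rightarrow> real ^ 'n")

definition chart_inv :: "('a, 'n::finite) chart \<Rightarrow> real ^ 'n \<Rightarrow> 'a" where
  "chart_inv c = inv_into (chart_dom c) (chart_map c)"

definition smooth_atlas ::
  "('a::{t2_space, second_countable_topology}, 'n::finite) chart set \<Rightarrow> bool" where
  "smooth_atlas A \<longleftrightarrow>
     (\<Union>c\<in>A. chart_dom c) = UNIV \<and>
     (\<forall>c\<in>A. open (chart_dom c) \<and> open (chart_map c ` chart_dom c) \<and>
        homeomorphism (chart_dom c) (chart_map c ` chart_dom c) (chart_map c) (chart_inv c)) \<and>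
     (\<forall>c\<in>A. \<forall>d\<in>A.
        smooth_on (chart_map c ` (chart_dom c \<inter> chart_dom d)) (chart_map d \<circ> chart_inv c))"

definition charts_at :: "('a, 'n::finite) chart set \<Rightarrow> 'a \<Rightarrow> ('a, 'n) chart set" where
  "charts_at A x = {c \<in> A. x \<in> chart_dom c}"

text \<open>Where a quantity does not depend on the chart around \<open>x\<close>, it is computed in this one.\<close>

definition some_chart :: "('a, 'n::finite) chart set \<Rightarrow> 'a \<Rightarrow> ('a, 'n) chart" where
  "some_chart A x = (SOME c. c \<in> charts_at A x)"

definition smooth_function :: "('a, 'n::finite) chart set \<Rightarrow> ('a \<Rightarrow> real) \<Rightarrow> bool" where
  "smooth_function A f \<longleftrightarrow> (\<forall>c\<in>A. smooth_on (chart_map c ` chart_dom c) (f \<circ> chart_inv c))"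


section \<open>Tangent vectors\<close>

text \<open>A tangent vector at \<open>x\<close> assigns to every chart around \<open>x\<close> a vector of components, and these
  are related by the Jacobians of the transition maps. Charts not containing \<open>x\<close> are assigned 0,
  so that equal tangent vectors are equal functions; the vector space structure is pointwise.\<close>

type_synonym ('a, 'n) tvec = "('a, 'n) chart \<Rightarrow> real ^ 'n"

definition tangent_space :: "('a, 'n::finite) chart set \<Rightarrow> 'a \<Rightarrow> ('a, 'n) tvec set" where
  "tangent_space A x = {X.
     (\<forall>c\<in>charts_at A x. \<forall>d\<in>charts_at A x.
        X d = frechet_derivative (chart_map d \<circ> chart_inv c) (at (chart_map c x)) (X c)) \<and>
     (\<forall>c. c \<notin> charts_at A x \<longrightarrow> X c = 0)}"

text \<open>The tangent vector at \<open>x\<close> with components \<open>u\<close> in the chart \<open>c\<close>.\<close>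

definition coord_vector ::
  "('a, 'n::finite) chart set \<Rightarrow> ('a, 'n) chart \<Rightarrow> 'a \<Rightarrow> real ^ 'n \<Rightarrow> ('a, 'n) tvec" where
  "coord_vector A c x u = (\<lambda>d. if d \<in> charts_at A x
     then frechet_derivative (chart_map d \<circ> chart_inv c) (at (chart_map c x)) u else 0)"

definition velocity ::
  "('a, 'n::finite) chart set \<Rightarrow> (real \<Rightarrow> 'a) \<Rightarrow> real \<Rightarrow> ('a, 'n) tvec" where
  "velocity A \<gamma> t = (\<lambda>d. if d \<in> charts_at A (\<gamma> t)
     then vector_derivative (\<lambda>s. chart_map d (\<gamma> s)) (at t) else 0)"

definition differential ::
  "('a, 'n::finite) chart set \<Rightarrow> ('a \<Rightarrow> real) \<Rightarrow> 'a \<Rightarrow> ('a, 'n) tvec \<Rightarrow> real" where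
  "differential A f x X = (let c = some_chart A x in
     frechet_derivative (f \<circ> chart_inv c) (at (chart_map c x)) (X c))"

definition tangent_map ::
  "('a, 'n::finite) chart set \<Rightarrow> ('a \<Rightarrow> 'a) \<Rightarrow> 'a \<Rightarrow> ('a, 'n) tvec \<Rightarrow> ('a, 'n) tvec" where
  "tangent_map A h x X = (let c = some_chart A x in
     (\<lambda>d. if d \<in> charts_at A (h x)
        then frechet_derivative (chart_map d \<circ> h \<circ> chart_inv c) (at (chart_map c x)) (X c) else 0))"


section \<open>Pseudo-Riemannian metrics and curvature\<close>

text \<open>Only the values \<open>g x X Y\<close> with \<open>X\<close>, \<open>Y\<close> tangent at \<open>x\<close> are meaningful.\<close>

type_synonym ('a, 'n) metric_field = "'a \<Rightarrow> ('a, 'n) tvec \<Rightarrow> ('a, 'n) tvec \<Rightarrow> real"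

definition metric_matrix ::
  "('a, 'n::finite) chart set \<Rightarrow> ('a, 'n) metric_field \<Rightarrow> ('a, 'n) chart \<Rightarrow> real ^ 'n \<Rightarrow> real ^ 'n ^ 'n"
  where
  "metric_matrix A g c y = (\<chi> i j. g (chart_inv c y)
     (coord_vector A c (chart_inv c y) (axis i 1)) (coord_vector A c (chart_inv c y) (axis j 1)))"

definition pseudo_riemannian_metric_on ::
  "('a::topological_space, 'n::finite) chart set \<Rightarrow> 'a set \<Rightarrow> ('a, 'n) metric_field \<Rightarrow> bool" where
  "pseudo_riemannian_metric_on A U g \<longleftrightarrow>
     open U \<and>
     (\<forall>x\<in>U. \<forall>X\<in>tangent_space A x. \<forall>Y\<in>tangent_space A x. g x X Y = g x Y X) \<and>
     (\<forall>x\<in>U. \<forall>X\<in>tangent_space A x. \<forall>Y\<in>tangent_space A x. \<forall>Z\<in>tangent_space A x. \<forall>a b.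
        g x (\<lambda>c. a *\<^sub>R X c + b *\<^sub>R Y c) Z = a * g x X Z + b * g x Y Z) \<and>
     (\<forall>x\<in>U. \<forall>X\<in>tangent_space A x.
        (\<forall>Y\<in>tangent_space A x. g x X Y = 0) \<longrightarrow> X = (\<lambda>_. 0)) \<and>
     (\<forall>c\<in>A. smooth_on (chart_map c ` (chart_dom c \<inter> U)) (metric_matrix A g c))"

definition partial :: "'n::finite \<Rightarrow> (real ^ 'n \<Rightarrow> real) \<Rightarrow> real ^ 'n \<Rightarrow> real" where
  "partial k h y = frechet_derivative h (at y) (axis k 1)"

text \<open>\<open>\<Gamma>\<^sup>k\<^sub>i\<^sub>j\<close> of the Levi-Civita connection, for a metric given by its coordinate matrix \<open>G\<close>.\<close>

definition christoffel ::
  "(real ^ 'n \<Rightarrow> real ^ 'n ^ 'n) \<Rightarrow> 'n::finite \<Rightarrow> 'n \<Rightarrow> 'n \<Rightarrow> real ^ 'n \<Rightarrow> real" where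
  "christoffel G k i j y = (\<Sum>l\<in>UNIV. matrix_inv (G y) $ k $ l *
     (partial i (\<lambda>z. G z $ j $ l) y + partial j (\<lambda>z. G z $ i $ l) y
        - partial l (\<lambda>z. G z $ i $ j) y)) / 2"

text \<open>The component \<open>R\<^sup>l\<^sub>k\<^sub>i\<^sub>j\<close>, with the convention
  \<open>R(\<partial>\<^sub>i, \<partial>\<^sub>j) \<partial>\<^sub>k = \<nabla>\<^sub>i \<nabla>\<^sub>j \<partial>\<^sub>k - \<nabla>\<^sub>j \<nabla>\<^sub>i \<partial>\<^sub>k = \<Sum>\<^sub>l R\<^sup>l\<^sub>k\<^sub>i\<^sub>j \<partial>\<^sub>l\<close>.\<close>

definition riemann ::
  "(real ^ 'n \<Rightarrow> real ^ 'n ^ 'n) \<Rightarrow> 'n::finite \<Rightarrow> 'n \<Rightarrow> 'n \<Rightarrow> 'n \<Rightarrow> real ^ 'n \<Rightarrow> real" where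
  "riemann G l k i j y =
     partial i (christoffel G l j k) y - partial j (christoffel G l i k) y +
     (\<Sum>m\<in>UNIV. christoffel G l i m y * christoffel G m j k y
              - christoffel G l j m y * christoffel G m i k y)"

text \<open>The tangent vector \<open>R(X, Y) Z\<close> at \<open>x\<close>, computed in the chart \<open>c\<close>.\<close>

definition curvature ::
  "('a, 'n::finite) chart set \<Rightarrow> ('a, 'n) metric_field \<Rightarrow> ('a, 'n) chart \<Rightarrow> 'a \<Rightarrow>
    ('a, 'n) tvec \<Rightarrow> ('a, 'n) tvec \<Rightarrow> ('a, 'n) tvec \<Rightarrow> ('a, 'n) tvec" where
  "curvature A g c x X Y Z = coord_vector A c x (\<chi> l. \<Sum>k\<in>UNIV. \<Sum>i\<in>UNIV. \<Sum>j\<in>UNIV.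
     riemann (metric_matrix A g c) l k i j (chart_map c x) * X c $ i * Y c $ j * Z c $ k)"

definition gram_det ::
  "('a, 'n::finite) metric_field \<Rightarrow> 'a \<Rightarrow> ('a, 'n) tvec \<Rightarrow> ('a, 'n) tvec \<Rightarrow> real" where
  "gram_det g x X Y = g x X X * g x Y Y - (g x X Y)\<^sup>2"

definition sectional_curvature ::
  "('a, 'n::finite) chart set \<Rightarrow> ('a, 'n) metric_field \<Rightarrow> ('a, 'n) chart \<Rightarrow> 'a \<Rightarrow>
    ('a, 'n) tvec \<Rightarrow> ('a, 'n) tvec \<Rightarrow> real" where
  "sectional_curvature A g c x X Y = g x (curvature A g c x X Y Y) X / gram_det g x X Y"

text \<open>As usual for indefinite metrics, only nondegenerate planes, i.e. those spanned by \<open>X\<close>, \<open>Y\<close>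
  with nonzero Gram determinant, have a sectional curvature. Curvature is independent of the chart;
  all charts around \<open>x\<close> are quantified over instead of choosing one.\<close>

definition has_constant_sectional_curvature_on ::
  "('a::topological_space, 'n::finite) chart set \<Rightarrow> 'a set \<Rightarrow> ('a, 'n) metric_field \<Rightarrow> real \<Rightarrow> bool"
  where
  "has_constant_sectional_curvature_on A U g C \<longleftrightarrow>
     pseudo_riemannian_metric_on A U g \<and>
     (\<forall>x\<in>U. \<forall>c\<in>charts_at A x. \<forall>X\<in>tangent_space A x. \<forall>Y\<in>tangent_space A x.
        gram_det g x X Y \<noteq> 0 \<longrightarrow> sectional_curvature A g c x X Y = C)"

definition flat_on ::
  "('a::topological_space, 'n::finite) chart set \<Rightarrow> 'a set \<Rightarrow> ('a, 'n) metric_field \<Rightarrow> bool" where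
  "flat_on A U g \<longleftrightarrow>
     pseudo_riemannian_metric_on A U g \<and>
     (\<forall>x\<in>U. \<forall>c\<in>charts_at A x.
        \<forall>X\<in>tangent_space A x. \<forall>Y\<in>tangent_space A x. \<forall>Z\<in>tangent_space A x.
          curvature A g c x X Y Z = (\<lambda>_. 0))"


section \<open>Free actions of the positive reals and homogeneous pairs\<close>

text \<open>Smoothness of the map \<open>(\<lambda>, x) \<mapsto> m \<lambda> x\<close> is expressed in the charts \<open>id \<times> c\<close> of the product
  manifold; \<open>m \<lambda>\<close> is meaningful only for \<open>\<lambda> > 0\<close>.\<close>

definition smooth_free_action ::
  "('a::topological_space, 'n::finite) chart set \<Rightarrow> (real \<Rightarrow> 'a \<Rightarrow> 'a) \<Rightarrow> bool" where
  "smooth_free_action A m \<longleftrightarrow>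
     (\<forall>x. m 1 x = x) \<and>
     (\<forall>a>0. \<forall>b>0. \<forall>x. m (a * b) x = m a (m b x)) \<and>
     (\<forall>a>0. \<forall>x. m a x = x \<longrightarrow> a = 1) \<and>
     continuous_on ({0<..} \<times> UNIV) (\<lambda>(a, x). m a x) \<and>
     (\<forall>c\<in>A. \<forall>d\<in>A.
        smooth_on {(a, y). a > 0 \<and> y \<in> chart_map c ` chart_dom c \<and> m a (chart_inv c y) \<in> chart_dom d}
          (\<lambda>(a, y). chart_map d (m a (chart_inv c y))))"

definition generator ::
  "('a, 'n::finite) chart set \<Rightarrow> (real \<Rightarrow> 'a \<Rightarrow> 'a) \<Rightarrow> 'a \<Rightarrow> ('a, 'n) tvec" where
  "generator A m x = velocity A (\<lambda>t. m (exp t) x) 0"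

definition homogeneous_pair ::
  "('a::topological_space, 'n::finite) chart set \<Rightarrow> (real \<Rightarrow> 'a \<Rightarrow> 'a) \<Rightarrow>
    ('a, 'n) metric_field \<Rightarrow> ('a \<Rightarrow> real) \<Rightarrow> real \<Rightarrow> bool" where
  "homogeneous_pair A m g f \<alpha> \<longleftrightarrow>
     \<alpha> \<noteq> 0 \<and>
     pseudo_riemannian_metric_on A UNIV g \<and>
     smooth_function A f \<and> (\<forall>x. f x > 0) \<and>
     (\<forall>a>0. \<forall>x. \<forall>X\<in>tangent_space A x. \<forall>Y\<in>tangent_space A x.
        g (m a x) (tangent_map A (m a) x X) (tangent_map A (m a) x Y) = a powr \<alpha> * g x X Y) \<and>
     (\<forall>a>0. \<forall>x. f (m a x) = a powr \<alpha> * f x) \<and>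
     (\<forall>x. \<forall>X\<in>tangent_space A x. g x (generator A m x) X = differential A f x X)"


section \<open>The function \<open>w\<close>\<close>

definition Delta1 :: "(real \<times> real \<times> real) set" where
  "Delta1 = {(s, C1, C2). s > 0 \<and> C1 > 0}"

definition Delta2 :: "(real \<times> real \<times> real) set" where
  "Delta2 = {(s, C1, C2). s = 0 \<and> C1 \<ge> 0}"

definition Delta3 :: "(real \<times> real \<times> real) set" where
  "Delta3 = {(s, C1, C2). s < 0 \<and> C1 \<le> 0}"

text \<open>\<open>\<sigma> \<in> {1, -1}\<close> is the choice of sign in the exponent, relevant only for \<open>s = 0\<close>. The function
  is meaningful only for \<open>(s, C1, C2)\<close> in the union of the three sets above and for \<open>r\<close> in
  \<open>w_domain s C1 C2\<close>.\<close>

definition w :: "real \<Rightarrow> real \<Rightarrow> real \<Rightarrow> real \<Rightarrow> real \<Rightarrow> real" where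
  "w \<sigma> s C1 C2 r =
     (if s > 0 then C1 / (s * (cosh (sqrt C1 * (ln r + C2)))\<^sup>2)
      else if s = 0 then exp C2 * r powr (\<sigma> * 2 * sqrt C1)
      else if C1 < 0 then C1 / (s * (sin (sqrt (- C1) * (ln r + C2)))\<^sup>2)
      else - 1 / (s * (ln r + C2)\<^sup>2))"

text \<open>The set of \<open>r > 0\<close> at which the denominator in the definition of \<open>w\<close> does not vanish.\<close>

definition w_domain :: "real \<Rightarrow> real \<Rightarrow> real \<Rightarrow> real set" where
  "w_domain s C1 C2 = {r. r > 0 \<and>
     (s < 0 \<and> C1 < 0 \<longrightarrow> sin (sqrt (- C1) * (ln r + C2)) \<noteq> 0) \<and>
     (s < 0 \<and> C1 = 0 \<longrightarrow> ln r + C2 \<noteq> 0)}"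

end

theory Submission
  imports Defs
begin

text \<open>Let \<open>P\<close> be the generator of the action. The hypotheses say that \<open>P\<close> is the gradient of \<open>f\<close>, that
\<open>L\<^sub>P g = \<alpha> g\<close> and that \<open>df(P) = \<alpha> f\<close>. They determine the covariant derivative of \<open>P\<close> for every
rescaled metric \<open>g' = v(f) g\<close>: the 1-form \<open>g'(P, \<cdot>) = v(f) df\<close> is closed, and \<open>L\<^sub>P g' = 2 h(f) g'\<close> with
\<open>h(r) = (\<alpha>/2) (1 + r v'(r) / v(r))\<close>. Hence \<open>\<nabla>' P = h(f) id\<close>, without any computation of \<open>\<nabla>'\<close> itself
(\<open>covariant_derivative\<close>, \<open>closed_conformal_field_rescaled\<close>), and a second differentiation gives
\<open>R'(X, Y) P = dh(X) Y - dh(Y) X\<close>, where \<open>dh\<close> stands for \<open>h'(f) df\<close> (\<open>riemann_field\<close>).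

The curvature of a surface is determined by the value of \<open>R'(X, Y)\<close> on one nonzero vector, because
\<open>R'(X, Y)\<close> is antisymmetric with respect to \<open>g'\<close>. Since \<open>df(P) = \<alpha> f\<close> does not vanish, \<open>P\<close> is such a
vector, and if \<open>h' = - C v\<close>, then \<open>dh = - C g'(P, \<cdot>)\<close> and
\<open>R'(X, Y) Z = C (g'(Y, Z) X - g'(X, Z) Y)\<close> for all \<open>Z\<close> (\<open>surface_riemann\<close>). For \<open>v(r) = w(r) / r\<close> the
equation \<open>h' = - C v\<close> becomes \<open>(log w)'' = - 2 (C / \<alpha>) w\<close>, the derivatives being taken with respect to
\<open>log r\<close>; the four formulas for \<open>w\<close> solve it (\<open>w_log_derivative\<close>). For a power \<open>v(r) = r\<^sup>\<beta>\<close> the function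
\<open>h\<close> is constant, so that \<open>C = 0\<close>.

Curvature is computed in an arbitrary chart. There the equation \<open>L\<^sub>P g = \<alpha> g\<close> is the derivative of
the homogeneity of \<open>g\<close> under \<open>m\<^sub>a\<close> at \<open>a = 1\<close>, for which the derivatives of the action in \<open>a\<close> and in
the coordinates have to be interchanged (\<open>homogeneous_local_metric_chart\<close>).\<close>


section \<open>Calculus of smooth functions\<close>

lemma Ck_on_cong:
  assumes "open S" and "\<And>x. x \<in> S \<Longrightarrow> h x = h' x" and "Ck_on k S h"
  shows "Ck_on k S h'"
  using assms(2,3)
proof (induction k arbitrary: h h')
  case 0
  then show ?case by (auto intro: continuous_on_eq)
next
  case (Suc k)
  have "(h' has_derivative frechet_derivative h (at x)) (at x)" if "x \<in> S" for x
  proof (rule has_derivative_transform_within_open[OF _ \<open>open S\<close> that])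
    show "(h has_derivative frechet_derivative h (at x)) (at x)"
      using Suc.prems(2) that frechet_derivative_works[of h "at x"] by simp
  qed (rule Suc.prems(1))
  then have D: "h' differentiable (at x)" "frechet_derivative h' (at x) = frechet_derivative h (at x)"
    if "x \<in> S" for x
    using that frechet_derivative_at unfolding differentiable_def by metis+
  have "Ck_on k S (\<lambda>x. frechet_derivative h' (at x) u)" for u
    by (rule Suc.IH[of "\<lambda>x. frechet_derivative h (at x) u"]) (use Suc.prems D in auto)
  with D show ?case by simp
qed

text \<open>Successive derivatives are most easily found as \<open>has_derivative\<close> facts, whereas \<^const>\<open>Ck_on\<close> speaks
of the selected derivative \<^const>\<open>frechet_derivative\<close>; on an open set the two agree. The closure
properties of \<^const>\<open>Ck_on\<close> are inductions on \<open>k\<close> through this rule: the derivative of a sum, product,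
inverse or composite is built by the same operations from functions of class \<open>C\<^sup>k\<close>.\<close>

lemma Ck_on_SucI:
  assumes "open S" and D: "\<And>x. x \<in> S \<Longrightarrow> (h has_derivative D x) (at x)"
    and "\<And>u. Ck_on k S (\<lambda>x. D x u)"
  shows "Ck_on (Suc k) S h"
proof -
  have "Ck_on k S (\<lambda>x. frechet_derivative h (at x) u)" for u
    by (rule Ck_on_cong[OF \<open>open S\<close> _ assms(3)[of u]]) (simp add: frechet_derivative_at[OF D])
  then show ?thesis using D by (auto simp: differentiable_def)
qed

lemma Ck_on_SucD: "Ck_on (Suc k) S h \<Longrightarrow> Ck_on k S h"
proof (induction k arbitrary: h)
  case 0
  then show ?case
    by (auto intro!: continuous_at_imp_continuous_on differentiable_imp_continuous_within)
next
  case (Suc k)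
  then show ?case by (auto simp del: Ck_on.simps simp add: Ck_on.simps(2)[of _ S])
qed

lemma Ck_on_has_derivative:
  "Ck_on (Suc k) S h \<Longrightarrow> x \<in> S \<Longrightarrow> (h has_derivative frechet_derivative h (at x)) (at x)"
  by (simp add: frechet_derivative_works)

lemma Ck_on_frechet: "Ck_on (Suc k) S h \<Longrightarrow> Ck_on k S (\<lambda>x. frechet_derivative h (at x) u)"
  by simp

lemma Ck_on_subset: "Ck_on k S h \<Longrightarrow> T \<subseteq> S \<Longrightarrow> Ck_on k T h"
  by (induction k arbitrary: h) (auto intro: continuous_on_subset)

lemma Ck_on_const: "Ck_on k S (\<lambda>_. c)"
  by (induction k arbitrary: c) auto

lemma Ck_on_add:
  assumes "open S"
  shows "Ck_on k S f \<Longrightarrow> Ck_on k S g \<Longrightarrow> Ck_on k S (\<lambda>x. f x + g x)"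
proof (induction k arbitrary: f g)
  case 0
  then show ?case by (auto intro: continuous_intros)
next
  case (Suc k)
  show ?case
    by (rule Ck_on_SucI[OF assms has_derivative_add, OF Ck_on_has_derivative Ck_on_has_derivative])
      (use Suc in auto)
qed

lemma Ck_on_linear:
  assumes "open S" and L: "bounded_linear L"
  shows "Ck_on k S f \<Longrightarrow> Ck_on k S (\<lambda>x. L (f x))"
proof (induction k arbitrary: f)
  case 0
  then show ?case by (auto intro: bounded_linear.continuous_on[OF L])
next
  case (Suc k)
  show ?case
    by (rule Ck_on_SucI[OF assms(1) bounded_linear.has_derivative[OF L], OF Ck_on_has_derivative])
      (use Suc in auto)
qed

lemma (in bounded_bilinear) Ck_on_prod:
  assumes "open S"
  shows "Ck_on k S f \<Longrightarrow> Ck_on k S g \<Longrightarrow> Ck_on k S (\<lambda>x. prod (f x) (g x))"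
proof (induction k arbitrary: f g)
  case 0
  then show ?case by (auto intro: continuous_on)
next
  case (Suc k)
  have "Ck_on k S f" "Ck_on k S g"
    using Suc.prems by (blast intro: Ck_on_SucD)+
  moreover have "Ck_on k S (\<lambda>x. frechet_derivative f (at x) u)"
    "Ck_on k S (\<lambda>x. frechet_derivative g (at x) u)" for u
    using Suc.prems by auto
  ultimately show ?case
    by (intro Ck_on_SucI[OF assms FDERIV, OF Ck_on_has_derivative[OF Suc.prems(1)]
          Ck_on_has_derivative[OF Suc.prems(2)]] Ck_on_add assms Suc.IH)
qed

lemmas Ck_on_mult = bounded_bilinear.Ck_on_prod[OF bounded_bilinear_mult]
lemmas Ck_on_scaleR = bounded_bilinear.Ck_on_prod[OF bounded_bilinear_scaleR]

lemma Ck_on_inverse: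
  fixes f :: "'a::real_normed_vector \<Rightarrow> real"
  assumes "open S" and nz: "\<And>x. x \<in> S \<Longrightarrow> f x \<noteq> 0"
  shows "Ck_on k S f \<Longrightarrow> Ck_on k S (\<lambda>x. inverse (f x))"
proof (induction k)
  case 0
  then show ?case using nz by (auto intro: continuous_intros)
next
  case (Suc k)
  have inv: "Ck_on k S (\<lambda>x. inverse (f x))"
    by (rule Suc.IH) (use Suc.prems Ck_on_SucD in blast)
  have "((\<lambda>x. inverse (f x)) has_derivative
     (\<lambda>u. - 1 * (inverse (f x) * frechet_derivative f (at x) u * inverse (f x)))) (at x)"
    if "x \<in> S" for x
    using Deriv.has_derivative_inverse[OF nz[OF that] Ck_on_has_derivative[OF Suc.prems that]] by simp
  then show ?case
    by (rule Ck_on_SucI[OF assms(1)])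
      (assumption | intro Ck_on_mult Ck_on_const assms inv Ck_on_frechet[OF Suc.prems])+
qed

lemma Ck_on_compose_real:
  fixes F :: "'a::real_normed_vector \<Rightarrow> real"
  assumes "open S" and "F ` S \<subseteq> T"
  shows "Ck_on k T v \<Longrightarrow> Ck_on k S F \<Longrightarrow> Ck_on k S (\<lambda>x. v (F x))"
proof (induction k arbitrary: v)
  case 0
  then show ?case using assms by (auto intro: continuous_on_compose2)
next
  case (Suc k)
  have D: "((\<lambda>x. v (F x)) has_derivative (\<lambda>u. frechet_derivative F (at x) u *\<^sub>R
      frechet_derivative v (at (F x)) 1)) (at x)" if "x \<in> S" for x
  proof -
    have v: "(v has_derivative frechet_derivative v (at (F x))) (at (F x))"
      using Suc.prems(1) that assms(2) by (blast intro: Ck_on_has_derivative)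
    have lin: "frechet_derivative v (at (F x)) r = r *\<^sub>R frechet_derivative v (at (F x)) 1" for r
      using linear_scale[OF has_derivative_linear[OF v], of r 1] by simp
    show ?thesis
      by (rule has_derivative_eq_rhs, rule has_derivative_compose[where f = F and g = v, OF _ v],
          rule Ck_on_has_derivative[OF Suc.prems(2) that], rule ext, rule lin)
  qed
  have "Ck_on k S (\<lambda>x. frechet_derivative v (at (F x)) 1)"
    by (rule Suc.IH[of "\<lambda>r. frechet_derivative v (at r) 1"])
      (use Suc.prems Ck_on_SucD in \<open>auto simp del: Ck_on.simps intro: Ck_on_frechet\<close>)
  then show ?case
    by (intro Ck_on_SucI[OF assms(1) D] Ck_on_scaleR[OF assms(1) Ck_on_frechet[OF Suc.prems(2)]])
qed

text \<open>Apply the mean value theorem first to \<open>t \<mapsto> h (x + s v + t u) - h (x + t u)\<close> and then, at the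
intermediate point, in the direction \<open>v\<close>.\<close>

lemma second_difference_mean_value:
  fixes h :: "'a::real_normed_vector \<Rightarrow> real"
  assumes C2: "Ck_on 2 S h" and "ball x r \<subseteq> S" and "0 < s" and "s * (norm u + norm v) < r"
  obtains z where "dist x z \<le> s * (norm u + norm v)"
    and "h (x + s *\<^sub>R u + s *\<^sub>R v) - h (x + s *\<^sub>R u) - h (x + s *\<^sub>R v) + h x
       = s\<^sup>2 * frechet_derivative (\<lambda>z. frechet_derivative h (at z) u) (at z) v"
proof -
  let ?D = "\<lambda>z. frechet_derivative h (at z)"
  let ?H = "\<lambda>z. frechet_derivative (\<lambda>z. ?D z u) (at z)"
  have bound: "norm (a *\<^sub>R u + b *\<^sub>R v) \<le> s * (norm u + norm v)"
    if "0 \<le> a" "a \<le> s" "0 \<le> b" "b \<le> s" for a b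
  proof -
    have "norm (a *\<^sub>R u + b *\<^sub>R v) \<le> a * norm u + b * norm v"
      using norm_triangle_ineq[of "a *\<^sub>R u" "b *\<^sub>R v"] that by simp
    also have "\<dots> \<le> s * norm u + s * norm v"
      using that by (intro add_mono mult_right_mono) auto
    finally show ?thesis by (simp add: algebra_simps)
  qed
  have mem: "x + a *\<^sub>R u + b *\<^sub>R v \<in> S" if "0 \<le> a" "a \<le> s" "0 \<le> b" "b \<le> s" for a b
  proof -
    have "dist x (x + a *\<^sub>R u + b *\<^sub>R v) = norm (a *\<^sub>R u + b *\<^sub>R v)"
      by (metis add.assoc add_diff_cancel_left' dist_norm norm_minus_commute)
    then show ?thesis using bound[OF that] assms by fastforce
  qed
  have h: "(h has_derivative ?D z) (at z)" if "z \<in> S" for z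
    using C2 that by (auto simp: numeral_2_eq_2 simp del: Ck_on.simps intro: Ck_on_has_derivative)
  have H: "((\<lambda>z. ?D z u) has_derivative ?H z) (at z)" if "z \<in> S" for z
    using Ck_on_frechet[of 1 S h u] C2 that
    by (auto simp: numeral_2_eq_2 simp del: Ck_on.simps intro: Ck_on_has_derivative)
  have line: "((\<lambda>t. k (y + t *\<^sub>R e)) has_real_derivative L e) (at t)"
    if "(k has_derivative L) (at (y + t *\<^sub>R e))" for k :: "'a \<Rightarrow> real" and L y e t
  proof -
    have "((\<lambda>t. y + t *\<^sub>R e) has_derivative (\<lambda>t. t *\<^sub>R e)) (at t)"
      by (auto intro!: derivative_eq_intros)
    from has_derivative_compose[OF this that]
    show ?thesis
      unfolding has_field_derivative_def
      by (rule has_derivative_eq_rhs)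
        (auto simp: linear_scale[OF has_derivative_linear[OF that]] mult.commute)
  qed
  have "((\<lambda>t. h (x + s *\<^sub>R v + t *\<^sub>R u) - h (x + t *\<^sub>R u)) has_real_derivative
     ?D (x + s *\<^sub>R v + t *\<^sub>R u) u - ?D (x + t *\<^sub>R u) u) (at t)" if "0 \<le> t" "t \<le> s" for t
    by (intro DERIV_diff line h)
      (use mem[of t 0] mem[of t s] that \<open>0 < s\<close> in \<open>auto simp: ac_simps\<close>)
  from MVT2[OF \<open>0 < s\<close> this]
  obtain a where a: "0 < a" "a < s"
    and ea: "(h (x + s *\<^sub>R v + s *\<^sub>R u) - h (x + s *\<^sub>R u)) - (h (x + s *\<^sub>R v) - h x)
       = s * (?D (x + s *\<^sub>R v + a *\<^sub>R u) u - ?D (x + a *\<^sub>R u) u)"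
    by auto
  have "((\<lambda>t. ?D (x + a *\<^sub>R u + t *\<^sub>R v) u) has_real_derivative
     ?H (x + a *\<^sub>R u + t *\<^sub>R v) v) (at t)" if "0 \<le> t" "t \<le> s" for t
    by (intro line[where k = "\<lambda>z. ?D z u"] H) (use mem[of a t] a that in auto)
  from MVT2[OF \<open>0 < s\<close> this]
  obtain b where b: "0 < b" "b < s"
    and eb: "?D (x + a *\<^sub>R u + s *\<^sub>R v) u - ?D (x + a *\<^sub>R u) u = s * ?H (x + a *\<^sub>R u + b *\<^sub>R v) v"
    by auto
  show thesis
  proof (rule that)
    show "dist x (x + a *\<^sub>R u + b *\<^sub>R v) \<le> s * (norm u + norm v)"
      using bound[of a b] a b
      by (metis add.assoc add_diff_cancel_left' dist_norm less_eq_real_def norm_minus_commute)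
    show "h (x + s *\<^sub>R u + s *\<^sub>R v) - h (x + s *\<^sub>R u) - h (x + s *\<^sub>R v) + h x
       = s\<^sup>2 * ?H (x + a *\<^sub>R u + b *\<^sub>R v) v"
      using ea eb by (simp add: algebra_simps power2_eq_square)
  qed
qed

text \<open>The second difference quotient is symmetric in \<open>u\<close> and \<open>v\<close>, so its two evaluations by the mean
value theorem agree; both evaluation points tend to \<open>x\<close>, where the mixed derivatives are
continuous.\<close>

lemma mixed_second_derivatives_commute:
  fixes h :: "'a::real_normed_vector \<Rightarrow> real"
  assumes "open S" and C2: "Ck_on 2 S h" and "x \<in> S"
  shows "frechet_derivative (\<lambda>z. frechet_derivative h (at z) u) (at x) v
       = frechet_derivative (\<lambda>z. frechet_derivative h (at z) v) (at x) u"
proof -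
  let ?H = "\<lambda>u v z. frechet_derivative (\<lambda>z. frechet_derivative h (at z) u) (at z) v"
  obtain r where r: "r > 0" "ball x r \<subseteq> S"
    using \<open>open S\<close> \<open>x \<in> S\<close> open_contains_ball by blast
  have cont: "continuous (at x) (?H u v)" for u v
    using C2 \<open>x \<in> S\<close> continuous_on_eq_continuous_at[OF \<open>open S\<close>, of "?H u v"]
    by (simp add: numeral_2_eq_2)
  have close: "\<bar>?H u v x - ?H v u x\<bar> < 2 * e" if "e > 0" for e
  proof -
    obtain d1 where d1: "d1 > 0" "\<And>z. dist x z < d1 \<Longrightarrow> \<bar>?H u v x - ?H u v z\<bar> < e"
      using cont[of u v] \<open>e > 0\<close> unfolding continuous_at_eps_delta
      by (metis dist_commute dist_real_def)
    obtain d2 where d2: "d2 > 0" "\<And>z. dist x z < d2 \<Longrightarrow> \<bar>?H v u x - ?H v u z\<bar> < e"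
      using cont[of v u] \<open>e > 0\<close> unfolding continuous_at_eps_delta
      by (metis dist_commute dist_real_def)
    define d where "d = min r (min d1 d2)"
    \<comment> \<open>The summand 1 makes the denominator positive also for \<open>u = v = 0\<close>.\<close>
    define s where "s = d / (norm u + norm v + 1)"
    have "d > 0" using r d1 d2 by (simp add: d_def)
    then have "s > 0" by (simp add: s_def add_nonneg_pos)
    have "s * (norm u + norm v + 1) = d"
      using add_nonneg_pos[of "norm u + norm v" 1] by (simp add: s_def)
    then have s: "s * (norm u + norm v) < d" using \<open>s > 0\<close> by (simp add: algebra_simps)
    obtain z1 where z1: "dist x z1 \<le> s * (norm u + norm v)"
      "h (x + s *\<^sub>R u + s *\<^sub>R v) - h (x + s *\<^sub>R u) - h (x + s *\<^sub>R v) + h x = s\<^sup>2 * ?H u v z1"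
      by (rule second_difference_mean_value[OF C2 r(2) \<open>s > 0\<close>, of u v]) (use s in \<open>auto simp: d_def\<close>)
    obtain z2 where z2: "dist x z2 \<le> s * (norm v + norm u)"
      "h (x + s *\<^sub>R v + s *\<^sub>R u) - h (x + s *\<^sub>R v) - h (x + s *\<^sub>R u) + h x = s\<^sup>2 * ?H v u z2"
      by (rule second_difference_mean_value[OF C2 r(2) \<open>s > 0\<close>, of v u])
        (use s in \<open>auto simp: d_def add.commute\<close>)
    have "s\<^sup>2 * ?H u v z1 = s\<^sup>2 * ?H v u z2"
      using z1(2) z2(2) by (simp add: algebra_simps)
    then have "?H u v z1 = ?H v u z2" using \<open>s > 0\<close> by simp
    moreover have "\<bar>?H u v x - ?H u v z1\<bar> < e" "\<bar>?H v u x - ?H v u z2\<bar> < e"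
      using z1(1) z2(1) s by (auto intro!: d1 d2 simp: d_def add.commute)
    ultimately show ?thesis by linarith
  qed
  show ?thesis
  proof (rule ccontr)
    assume "?H u v x \<noteq> ?H v u x"
    then show False using close[of "\<bar>?H u v x - ?H v u x\<bar> / 2"] by simp
  qed
qed

lemma smooth_onI: "(\<And>k. Ck_on k S h) \<Longrightarrow> smooth_on S h"
  by (simp add: smooth_on_def)

lemma smooth_on_cong:
  "open S \<Longrightarrow> (\<And>x. x \<in> S \<Longrightarrow> h x = h' x) \<Longrightarrow> smooth_on S h \<Longrightarrow> smooth_on S h'"
  using Ck_on_cong unfolding smooth_on_def by blast

lemma smooth_on_subset: "smooth_on S h \<Longrightarrow> T \<subseteq> S \<Longrightarrow> smooth_on T h"
  using Ck_on_subset unfolding smooth_on_def by blast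

lemma smooth_on_has_derivative:
  "smooth_on S h \<Longrightarrow> x \<in> S \<Longrightarrow> (h has_derivative frechet_derivative h (at x)) (at x)"
  using Ck_on_has_derivative unfolding smooth_on_def by blast

lemma smooth_on_differentiable: "smooth_on S h \<Longrightarrow> x \<in> S \<Longrightarrow> h differentiable (at x)"
  using smooth_on_has_derivative differentiableI by blast

lemma smooth_on_frechet: "smooth_on S h \<Longrightarrow> smooth_on S (\<lambda>x. frechet_derivative h (at x) u)"
  using Ck_on_frechet unfolding smooth_on_def by blast

lemma smooth_on_const: "smooth_on S (\<lambda>_. c)"
  by (rule smooth_onI Ck_on_const)+

lemma smooth_on_add:
  "open S \<Longrightarrow> smooth_on S f \<Longrightarrow> smooth_on S g \<Longrightarrow> smooth_on S (\<lambda>x. f x + g x)"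
  unfolding smooth_on_def by (blast intro: Ck_on_add)

lemma smooth_on_mult:
  fixes f g :: "'a::real_normed_vector \<Rightarrow> real"
  shows "open S \<Longrightarrow> smooth_on S f \<Longrightarrow> smooth_on S g \<Longrightarrow> smooth_on S (\<lambda>x. f x * g x)"
  unfolding smooth_on_def by (blast intro: Ck_on_mult)

lemma smooth_on_scaleR:
  "open S \<Longrightarrow> smooth_on S f \<Longrightarrow> smooth_on S g \<Longrightarrow> smooth_on S (\<lambda>x. f x *\<^sub>R g x)"
  unfolding smooth_on_def by (blast intro: Ck_on_scaleR)

lemma smooth_on_inverse:
  fixes f :: "'a::real_normed_vector \<Rightarrow> real"
  shows "open S \<Longrightarrow> (\<And>x. x \<in> S \<Longrightarrow> f x \<noteq> 0) \<Longrightarrow> smooth_on S f \<Longrightarrow>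
    smooth_on S (\<lambda>x. inverse (f x))"
  unfolding smooth_on_def by (blast intro: Ck_on_inverse)

lemma smooth_on_linear:
  "open S \<Longrightarrow> bounded_linear L \<Longrightarrow> smooth_on S f \<Longrightarrow> smooth_on S (\<lambda>x. L (f x))"
  unfolding smooth_on_def by (blast intro: Ck_on_linear)

lemma smooth_on_compose_real:
  fixes F :: "'a::real_normed_vector \<Rightarrow> real"
  shows "open S \<Longrightarrow> F ` S \<subseteq> T \<Longrightarrow> smooth_on T v \<Longrightarrow> smooth_on S F \<Longrightarrow>
    smooth_on S (\<lambda>x. v (F x))"
  unfolding smooth_on_def by (blast intro: Ck_on_compose_real)

lemma smooth_on_diff:
  fixes f g :: "'a::real_normed_vector \<Rightarrow> real"
  assumes "open S" "smooth_on S f" "smooth_on S g"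
  shows "smooth_on S (\<lambda>x. f x - g x)"
  using smooth_on_add[OF assms(1,2) smooth_on_mult[OF assms(1) smooth_on_const assms(3)], of "-1"]
  by simp

lemma smooth_on_sum:
  "open S \<Longrightarrow> (\<And>i. i \<in> I \<Longrightarrow> smooth_on S (f i)) \<Longrightarrow> smooth_on S (\<lambda>x. \<Sum>i\<in>I. f i x)"
  by (induction I rule: infinite_finite_induct) (auto intro: smooth_on_const smooth_on_add)

lemma smooth_on_prod:
  fixes f :: "'i \<Rightarrow> 'a::real_normed_vector \<Rightarrow> real"
  shows "open S \<Longrightarrow> (\<And>i. i \<in> I \<Longrightarrow> smooth_on S (f i)) \<Longrightarrow> smooth_on S (\<lambda>x. \<Prod>i\<in>I. f i x)"
  by (induction I rule: infinite_finite_induct) (auto intro: smooth_on_const smooth_on_mult)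

lemma smooth_on_vec_nth: "open S \<Longrightarrow> smooth_on S f \<Longrightarrow> smooth_on S (\<lambda>x. f x $ i)"
  by (rule smooth_on_linear[OF _ bounded_linear_vec_nth])

lemma smooth_on_det:
  fixes M :: "'a::real_normed_vector \<Rightarrow> real ^ 'n ^ 'n"
  assumes "open S" and "\<And>i j. smooth_on S (\<lambda>x. M x $ i $ j)"
  shows "smooth_on S (\<lambda>x. det (M x))"
  unfolding det_def by (intro smooth_on_sum smooth_on_mult smooth_on_prod smooth_on_const assms)

lemma matrix_inv_right:
  fixes A :: "real ^ 'n ^ 'n"
  assumes "invertible A"
  shows "A ** matrix_inv A = mat 1"
  using someI_ex[OF assms[unfolded invertible_def]] unfolding matrix_inv_def by blast

text \<open>Cramer's rule shows that the inverse matrix depends smoothly on the matrix.\<close>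

lemma matrix_inv_entry:
  fixes A :: "real ^ 'n ^ 'n"
  assumes "invertible A"
  shows "matrix_inv A $ k $ l =
    det (\<chi> i j. if j = k then axis l 1 $ i else A $ i $ j) * inverse (det A)"
proof -
  have "A *v (matrix_inv A *v axis l 1) = axis l 1"
    by (simp add: matrix_vector_mul_assoc matrix_inv_right[OF assms])
  then have "matrix_inv A *v axis l 1 =
      (\<chi> k. det (\<chi> i j. if j = k then axis l 1 $ i else A $ i $ j) / det A)"
    using cramer[of A] assms by (simp add: invertible_det_nz)
  then have "(matrix_inv A *v axis l 1) $ k =
      det (\<chi> i j. if j = k then axis l 1 $ i else A $ i $ j) / det A"
    by (simp add: vec_eq_iff)
  then show ?thesis
    by (simp add: matrix_vector_mult_basis column_def divide_inverse)
qed

lemma smooth_on_matrix_inv_entry: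
  fixes M :: "'a::real_normed_vector \<Rightarrow> real ^ 'n ^ 'n"
  assumes "open S" and M: "\<And>i j. smooth_on S (\<lambda>x. M x $ i $ j)"
    and inv: "\<And>x. x \<in> S \<Longrightarrow> invertible (M x)"
  shows "smooth_on S (\<lambda>x. matrix_inv (M x) $ k $ l)"
proof -
  have "smooth_on S (\<lambda>x. (\<chi> i j. if j = k then axis l 1 $ i else M x $ i $ j) $ i $ j)" for i j
    using M[of i j] by (cases "j = k") (auto simp: smooth_on_const)
  then have "smooth_on S (\<lambda>x. det (\<chi> i j. if j = k then axis l 1 $ i else M x $ i $ j)
      * inverse (det (M x)))"
    using inv by (intro smooth_on_mult smooth_on_inverse smooth_on_det assms)
      (auto simp: invertible_det_nz)
  then show ?thesis
    by (rule smooth_on_cong[OF assms(1), rotated]) (simp add: matrix_inv_entry inv)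
qed

lemma partial_eqI: "(h has_derivative D) (at y) \<Longrightarrow> partial k h y = D (axis k 1)"
  by (simp add: partial_def flip: frechet_derivative_at)

lemma partial_cong:
  assumes "open S" "y \<in> S" and eq: "\<And>z. z \<in> S \<Longrightarrow> h z = h' z" and "h differentiable (at y)"
  shows "partial k h y = partial k h' y"
  using frechet_derivative_transform_within_open[OF assms(4,1,2) eq] by (simp add: partial_def)

lemma partial_const: "partial k (\<lambda>_. c) y = 0"
  by (simp add: partial_def)

lemma partial_add:
  "f differentiable (at y) \<Longrightarrow> g differentiable (at y) \<Longrightarrow>
    partial k (\<lambda>z. f z + g z) y = partial k f y + partial k g y"
  by (subst partial_eqI[OF has_derivative_add]) (auto simp: frechet_derivative_works partial_def)

lemma partial_mult:
  "f differentiable (at y) \<Longrightarrow> g differentiable (at y) \<Longrightarrow>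
    partial k (\<lambda>z. f z * g z) y = partial k f y * g y + f y * partial k g y"
  by (subst partial_eqI[OF has_derivative_mult]) (auto simp: frechet_derivative_works partial_def)

lemma partial_sum:
  "(\<And>i. i \<in> I \<Longrightarrow> f i differentiable (at y)) \<Longrightarrow>
    partial k (\<lambda>z. \<Sum>i\<in>I. f i z) y = (\<Sum>i\<in>I. partial k (f i) y)"
  by (subst partial_eqI[OF has_derivative_sum]) (auto simp: frechet_derivative_works partial_def)

lemma partial_compose:
  assumes "(v has_real_derivative v') (at (F y))" and "F differentiable (at y)"
  shows "partial k (\<lambda>z. v (F z)) y = v' * partial k F y"
proof -
  have "((\<lambda>z. v (F z)) has_derivative (\<lambda>u. v' * frechet_derivative F (at y) u)) (at y)"
    using has_derivative_compose[of F _ y UNIV v "\<lambda>r. v' * r"] assms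
    by (simp add: frechet_derivative_works has_field_derivative_def)
  from partial_eqI[OF this] show ?thesis by (simp add: partial_def)
qed

lemma frechet_derivative_partials:
  fixes h :: "real ^ 'n::finite \<Rightarrow> real"
  assumes "h differentiable (at y)"
  shows "frechet_derivative h (at y) u = (\<Sum>q\<in>UNIV. partial q h y * u $ q)"
proof -
  have lin: "linear (frechet_derivative h (at y))"
    by (rule linear_frechet_derivative[OF assms])
  have "frechet_derivative h (at y) (\<Sum>q\<in>UNIV. u $ q *\<^sub>R axis q 1)
      = (\<Sum>q\<in>UNIV. u $ q * frechet_derivative h (at y) (axis q 1))"
    by (simp add: linear_sum[OF lin] linear_scale[OF lin])
  moreover have "(\<Sum>q\<in>UNIV. u $ q *\<^sub>R axis q 1) = u"
    using basis_expansion[of u] by (simp add: scalar_mult_eq_scaleR)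
  ultimately show ?thesis by (simp add: partial_def mult.commute)
qed

lemma smooth_on_partial: "smooth_on S h \<Longrightarrow> smooth_on S (partial k h)"
  using smooth_on_frechet[of S h "axis k 1"] by (simp add: partial_def[abs_def])

lemma partials_commute:
  assumes "open S" "smooth_on S h" "y \<in> S"
  shows "partial i (partial j h) y = partial j (partial i h) y"
  using mixed_second_derivatives_commute[OF assms(1) _ assms(3)] assms(2)
  unfolding smooth_on_def partial_def by blast


section \<open>The Levi-Civita calculus in coordinates\<close>

locale local_metric =
  fixes S :: "(real ^ 'n::finite) set" and G :: "real ^ 'n \<Rightarrow> real ^ 'n ^ 'n"
  assumes open_S: "open S"
    and smooth_G: "smooth_on S G"
    and sym: "y \<in> S \<Longrightarrow> G y $ i $ j = G y $ j $ i"
    and nondegenerate: "y \<in> S \<Longrightarrow> invertible (G y)"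
begin

lemma smooth_entry: "smooth_on S (\<lambda>y. G y $ i $ j)"
  by (intro smooth_on_vec_nth open_S smooth_G)

lemma smooth_christoffel: "smooth_on S (christoffel G k i j)"
proof -
  have "smooth_on S (\<lambda>y. (\<Sum>l\<in>UNIV. matrix_inv (G y) $ k $ l *
     (partial i (\<lambda>z. G z $ j $ l) y + partial j (\<lambda>z. G z $ i $ l) y
        - partial l (\<lambda>z. G z $ i $ j) y)) * (1/2))"
    by (intro smooth_on_mult smooth_on_sum smooth_on_diff smooth_on_add smooth_on_const open_S
        smooth_on_matrix_inv_entry smooth_on_partial smooth_entry nondegenerate)
  then show ?thesis by (simp add: christoffel_def[abs_def])
qed

lemmas diff_entry = smooth_on_differentiable[OF smooth_entry]
lemmas diff_christoffel = smooth_on_differentiable[OF smooth_christoffel]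

lemma partial_entry_sym:
  assumes "y \<in> S"
  shows "partial k (\<lambda>z. G z $ i $ j) y = partial k (\<lambda>z. G z $ j $ i) y"
  by (rule partial_cong[OF open_S assms]) (auto intro: sym diff_entry assms)

lemma christoffel_sym: "y \<in> S \<Longrightarrow> christoffel G k i j y = christoffel G k j i y"
  using partial_entry_sym[of y _ i j] by (simp add: christoffel_def add.commute)

text \<open>The Christoffel symbols of the first kind \<open>\<Gamma>\<^sub>l\<^sub>i\<^sub>j\<close>. They involve no inverse matrix, and computations
with covariant components go through them.\<close>

definition lowered_christoffel :: "'n \<Rightarrow> 'n \<Rightarrow> 'n \<Rightarrow> real ^ 'n \<Rightarrow> real" where
  "lowered_christoffel l i j y = (\<Sum>m\<in>UNIV. G y $ l $ m * christoffel G m i j y)"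

lemma lowered_christoffel_eq:
  assumes "y \<in> S"
  shows "lowered_christoffel l i j y =
    (partial i (\<lambda>z. G z $ j $ l) y + partial j (\<lambda>z. G z $ i $ l) y
        - partial l (\<lambda>z. G z $ i $ j) y) / 2"
proof -
  define X where "X = (\<chi> l. (partial i (\<lambda>z. G z $ j $ l) y + partial j (\<lambda>z. G z $ i $ l) y
        - partial l (\<lambda>z. G z $ i $ j) y) / 2)"
  have "christoffel G m i j y = (matrix_inv (G y) *v X) $ m" for m
    by (simp add: christoffel_def matrix_vector_mult_def X_def sum_divide_distrib)
  then have "lowered_christoffel l i j y = (G y *v (matrix_inv (G y) *v X)) $ l"
    by (simp add: lowered_christoffel_def matrix_vector_mult_def)
  then show ?thesis
    by (simp add: matrix_vector_mul_assoc matrix_inv_right nondegenerate assms X_def)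
qed

lemma metric_compatible:
  assumes "y \<in> S"
  shows "partial i (\<lambda>z. G z $ l $ m) y = lowered_christoffel l i m y + lowered_christoffel m i l y"
  using partial_entry_sym[OF assms] by (simp add: lowered_christoffel_eq assms field_simps)

lemma smooth_lowered_christoffel: "smooth_on S (lowered_christoffel l i j)"
  unfolding lowered_christoffel_def[abs_def]
  by (intro smooth_on_sum smooth_on_mult smooth_entry smooth_christoffel open_S)

text \<open>Lowering the index \<open>m\<close> inside \<open>\<partial>\<^sub>i \<Gamma>\<^sup>m\<^sub>j\<^sub>k\<close> costs \<open>\<partial>\<^sub>i G\<^sub>l\<^sub>m = \<Gamma>\<^sub>l\<^sub>i\<^sub>m + \<Gamma>\<^sub>m\<^sub>i\<^sub>l\<close>; the first of these two terms
cancels the quadratic part of the curvature.\<close>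

lemma lowered_riemann:
  assumes y: "y \<in> S"
  shows "(\<Sum>m\<in>UNIV. G y $ l $ m * riemann G m k i j y) =
    partial i (lowered_christoffel l j k) y - partial j (lowered_christoffel l i k) y
    - (\<Sum>m\<in>UNIV. lowered_christoffel m i l y * christoffel G m j k y)
    + (\<Sum>m\<in>UNIV. lowered_christoffel m j l y * christoffel G m i k y)"
proof -
  let ?L = lowered_christoffel and ?\<Gamma> = "christoffel G"
  have D: "(\<Sum>m\<in>UNIV. G y $ l $ m * partial i (?\<Gamma> m j k) y) =
      partial i (?L l j k) y - (\<Sum>m\<in>UNIV. ?L l i m y * ?\<Gamma> m j k y)
        - (\<Sum>m\<in>UNIV. ?L m i l y * ?\<Gamma> m j k y)" for i j
  proof -
    have "partial i (?L l j k) y = (\<Sum>m\<in>UNIV. partial i (\<lambda>z. G z $ l $ m * ?\<Gamma> m j k z) y)"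
      unfolding lowered_christoffel_def[abs_def]
      by (rule partial_sum) (intro differentiable_mult diff_entry diff_christoffel y)
    also have "\<dots> = (\<Sum>m\<in>UNIV. partial i (\<lambda>z. G z $ l $ m) y * ?\<Gamma> m j k y
        + G y $ l $ m * partial i (?\<Gamma> m j k) y)"
      by (intro sum.cong refl partial_mult diff_entry diff_christoffel y)
    finally show ?thesis
      by (simp add: metric_compatible[OF y] sum.distrib algebra_simps)
  qed
  have Q: "(\<Sum>m\<in>UNIV. G y $ l $ m * (\<Sum>q\<in>UNIV. ?\<Gamma> m i q y * ?\<Gamma> q j k y)) =
      (\<Sum>q\<in>UNIV. ?L l i q y * ?\<Gamma> q j k y)" for i j
    unfolding lowered_christoffel_def sum_distrib_left sum_distrib_right
    by (subst sum.swap) (simp add: mult.assoc)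
  have "(\<Sum>m\<in>UNIV. G y $ l $ m * riemann G m k i j y) =
      (\<Sum>m\<in>UNIV. G y $ l $ m * partial i (?\<Gamma> m j k) y)
      - (\<Sum>m\<in>UNIV. G y $ l $ m * partial j (?\<Gamma> m i k) y)
      + (\<Sum>m\<in>UNIV. G y $ l $ m * (\<Sum>q\<in>UNIV. ?\<Gamma> m i q y * ?\<Gamma> q j k y))
      - (\<Sum>m\<in>UNIV. G y $ l $ m * (\<Sum>q\<in>UNIV. ?\<Gamma> m j q y * ?\<Gamma> q i k y))"
    by (simp add: riemann_def sum_subtractf sum.distrib algebra_simps)
  then show ?thesis unfolding D Q by simp
qed

text \<open>In the sum over the two orders of \<open>l\<close> and \<open>k\<close>, the derivatives of Christoffel symbols combine to
\<open>\<partial>\<^sub>i \<partial>\<^sub>j G\<^sub>l\<^sub>k - \<partial>\<^sub>j \<partial>\<^sub>i G\<^sub>l\<^sub>k = 0\<close>, and the quadratic terms cancel because \<open>\<Sum>\<^sub>m \<Gamma>\<^sub>m\<^sub>a\<^sub>b \<Gamma>\<^sup>m\<^sub>c\<^sub>d\<close> is symmetric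
in the pairs \<open>(a, b)\<close> and \<open>(c, d)\<close>.\<close>

lemma lowered_riemann_antisym:
  assumes y: "y \<in> S"
  shows "(\<Sum>m\<in>UNIV. G y $ l $ m * riemann G m k i j y) =
    - (\<Sum>m\<in>UNIV. G y $ k $ m * riemann G m l i j y)"
proof -
  let ?L = lowered_christoffel and ?\<Gamma> = "christoffel G"
  have Q: "(\<Sum>m\<in>UNIV. ?L m a b y * ?\<Gamma> m c d y) = (\<Sum>m\<in>UNIV. ?L m c d y * ?\<Gamma> m a b y)"
    for a b c d
    unfolding lowered_christoffel_def sum_distrib_right
    by (subst sum.swap) (simp add: sym[OF y, of _ m for m] ac_simps)
  have "partial i (?L l j k) y + partial i (?L k j l) y
      = partial i (partial j (\<lambda>z. G z $ l $ k)) y" for i j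
  proof -
    have "partial i (\<lambda>z. ?L l j k z + ?L k j l z) y = partial i (partial j (\<lambda>z. G z $ l $ k)) y"
      by (rule partial_cong[OF open_S y])
        (auto simp: metric_compatible intro!: derivative_intros
          smooth_on_differentiable[OF smooth_lowered_christoffel] y)
    then show ?thesis
      by (simp add: partial_add smooth_on_differentiable[OF smooth_lowered_christoffel y])
  qed
  from this[of i j] this[of j i] partials_commute[OF open_S smooth_entry y, of i j l k]
  show ?thesis
    unfolding lowered_riemann[OF y] using Q[of i l j k] Q[of j l i k] by linarith
qed

lemma mult_metric_eq_0: "y \<in> S \<Longrightarrow> G y *v x = 0 \<Longrightarrow> x = 0"
  using nondegenerate by (metis invertible_def matrix_left_invertible_ker)

end


section \<open>Closed conformal vector fields\<close>

text \<open>The first condition on the field \<open>p\<close> says that the 1-form \<open>G(p, \<cdot>)\<close> is closed, the second one is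
\<open>L\<^sub>p G = 2 h G\<close> written out in coordinates.\<close>

locale closed_conformal_field = local_metric S G
  for S :: "(real ^ 'n::finite) set" and G :: "real ^ 'n \<Rightarrow> real ^ 'n ^ 'n" +
  fixes p :: "real ^ 'n \<Rightarrow> real ^ 'n" and h :: "real ^ 'n \<Rightarrow> real"
  assumes smooth_p: "smooth_on S (\<lambda>y. p y $ k)"
    and smooth_h: "smooth_on S h"
    and closed: "y \<in> S \<Longrightarrow> partial i (\<lambda>z. \<Sum>k\<in>UNIV. G z $ j $ k * p z $ k) y
        = partial j (\<lambda>z. \<Sum>k\<in>UNIV. G z $ i $ k * p z $ k) y"
    and conformal: "y \<in> S \<Longrightarrow>
      (\<Sum>k\<in>UNIV. partial k (\<lambda>z. G z $ i $ j) y * p y $ k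
         + G y $ k $ j * partial i (\<lambda>z. p z $ k) y
         + G y $ i $ k * partial j (\<lambda>z. p z $ k) y) = 2 * h y * G y $ i $ j"
begin

lemmas diff_p = smooth_on_differentiable[OF smooth_p]

text \<open>\<open>\<nabla>p = h \<cdot> id\<close>: the antisymmetric part of \<open>G(\<nabla>p, \<cdot>)\<close> is half of the exterior derivative of the closed form
\<open>G(p, \<cdot>)\<close> and its symmetric part is half of \<open>L\<^sub>p G\<close>. In coordinates the equation is checked after
multiplication by the invertible matrix \<open>G\<close>.\<close>

lemma covariant_derivative:
  assumes y: "y \<in> S"
  shows "partial i (\<lambda>z. p z $ l) y + (\<Sum>m\<in>UNIV. christoffel G l i m y * p y $ m)
    = (if l = i then h y else 0)"
proof -
  let ?L = lowered_christoffel and ?\<Gamma> = "christoffel G"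
  define x where "x = (\<chi> l. partial i (\<lambda>z. p z $ l) y + (\<Sum>m\<in>UNIV. ?\<Gamma> l i m y * p y $ m)
    - (if l = i then h y else 0))"
  have "(G y *v x) $ j = 0" for j
  proof -
    have pm: "partial i (\<lambda>z. \<Sum>k\<in>UNIV. G z $ j $ k * p z $ k) y =
        (\<Sum>k\<in>UNIV. partial i (\<lambda>z. G z $ j $ k) y * p y $ k)
        + (\<Sum>k\<in>UNIV. G y $ j $ k * partial i (\<lambda>z. p z $ k) y)" for i j
      by (subst partial_sum)
        (simp_all add: partial_mult diff_p diff_entry y differentiable_mult sum.distrib)
    have "(\<Sum>l\<in>UNIV. G y $ j $ l * (\<Sum>m\<in>UNIV. ?\<Gamma> l i m y * p y $ m))
        = (\<Sum>m\<in>UNIV. ?L j i m y * p y $ m)"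
      unfolding lowered_christoffel_def sum_distrib_left sum_distrib_right
      by (subst sum.swap) (simp add: mult.assoc)
    also have "\<dots> = ((\<Sum>m\<in>UNIV. partial i (\<lambda>z. G z $ j $ m) y * p y $ m)
        + (\<Sum>m\<in>UNIV. partial m (\<lambda>z. G z $ i $ j) y * p y $ m)
        - (\<Sum>m\<in>UNIV. partial j (\<lambda>z. G z $ i $ m) y * p y $ m)) / 2"
      unfolding lowered_christoffel_eq[OF y] partial_entry_sym[OF y, of i _ j]
      by (simp add: sum.distrib sum_subtractf sum_divide_distrib algebra_simps add_divide_distrib
          diff_divide_distrib)
    finally have 1: "(\<Sum>l\<in>UNIV. G y $ j $ l * (\<Sum>m\<in>UNIV. ?\<Gamma> l i m y * p y $ m)) = \<dots>" .
    have 2: "(\<Sum>l\<in>UNIV. G y $ j $ l * (if l = i then h y else 0)) = h y * G y $ i $ j"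
      by (simp add: sym[OF y, of j i] if_distrib[of "\<lambda>t. _ * t"] cong: if_cong)
    have 3: "(G y *v x) $ j = (\<Sum>l\<in>UNIV. G y $ j $ l * partial i (\<lambda>z. p z $ l) y)
        + (\<Sum>l\<in>UNIV. G y $ j $ l * (\<Sum>m\<in>UNIV. ?\<Gamma> l i m y * p y $ m))
        - (\<Sum>l\<in>UNIV. G y $ j $ l * (if l = i then h y else 0))"
      by (simp add: matrix_vector_mult_def x_def sum.distrib sum_subtractf distrib_left
          right_diff_distrib)
    have 4: "(\<Sum>k\<in>UNIV. partial k (\<lambda>z. G z $ i $ j) y * p y $ k)
        + (\<Sum>k\<in>UNIV. G y $ j $ k * partial i (\<lambda>z. p z $ k) y)
        + (\<Sum>k\<in>UNIV. G y $ i $ k * partial j (\<lambda>z. p z $ k) y) = 2 * (h y * G y $ i $ j)"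
      using conformal[OF y, of i j] by (simp add: sum.distrib sym[OF y, of _ j])
    show ?thesis
      using closed[OF y, of i j] 4 unfolding 1 2 3 pm by argo
  qed
  then have "G y *v x = 0" by (subst vec_eq_iff) simp
  from mult_metric_eq_0[OF y this] have "x $ l = 0" by simp
  then show ?thesis by (simp add: x_def)
qed

text \<open>Differentiating \<open>\<nabla>p = h \<cdot> id\<close> once more and antisymmetrizing gives
\<open>R(\<partial>\<^sub>i, \<partial>\<^sub>j) p = (\<partial>\<^sub>i h) \<partial>\<^sub>j - (\<partial>\<^sub>j h) \<partial>\<^sub>i\<close>.\<close>

lemma riemann_field:
  assumes y: "y \<in> S"
  shows "(\<Sum>k\<in>UNIV. riemann G l k i j y * p y $ k) =
    (if l = j then partial i h y else 0) - (if l = i then partial j h y else 0)"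
proof -
  let ?\<Gamma> = "christoffel G"
  \<comment> \<open>The derivative of \<open>(\<nabla>\<^sub>j p)\<^sup>l = h \<delta>\<^sup>l\<^sub>j\<close>, with the first derivatives of \<open>p\<close> eliminated.\<close>
  have E: "partial i (partial j (\<lambda>z. p z $ l)) y
      + (\<Sum>k\<in>UNIV. partial i (?\<Gamma> l j k) y * p y $ k)
      + ?\<Gamma> l j i y * h y - (\<Sum>k\<in>UNIV. (\<Sum>m\<in>UNIV. ?\<Gamma> l j m y * ?\<Gamma> m i k y) * p y $ k)
      = (if l = j then partial i h y else 0)" for i j
  proof -
    have d: "(\<lambda>z. if l = j then h z else 0) differentiable (at y)"
      using smooth_on_differentiable[OF smooth_h y] by (cases "l = j") auto
    have "(if l = j then partial i h y else 0) = partial i (\<lambda>z. if l = j then h z else 0) y"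
      by (simp add: partial_const)
    also have "\<dots> = partial i (\<lambda>z. partial j (\<lambda>z. p z $ l) z
        + (\<Sum>k\<in>UNIV. ?\<Gamma> l j k z * p z $ k)) y"
      by (rule partial_cong[OF open_S y _ d]) (simp add: covariant_derivative)
    also have "\<dots> = partial i (partial j (\<lambda>z. p z $ l)) y
        + (\<Sum>k\<in>UNIV. partial i (?\<Gamma> l j k) y * p y $ k)
        + (\<Sum>k\<in>UNIV. ?\<Gamma> l j k y * partial i (\<lambda>z. p z $ k) y)"
      by (simp add: partial_add partial_sum partial_mult diff_p diff_christoffel y sum.distrib
          differentiable_mult differentiable_sum smooth_on_differentiable[OF smooth_on_partial[OF smooth_p]])
    also have "(\<Sum>k\<in>UNIV. ?\<Gamma> l j k y * partial i (\<lambda>z. p z $ k) y)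
        = (\<Sum>k\<in>UNIV. ?\<Gamma> l j k y * (if k = i then h y else 0))
        - (\<Sum>k\<in>UNIV. ?\<Gamma> l j k y * (\<Sum>m\<in>UNIV. ?\<Gamma> k i m y * p y $ m))"
      unfolding sum_subtractf[symmetric] covariant_derivative[OF y, symmetric]
      by (simp add: algebra_simps)
    also have "(\<Sum>k\<in>UNIV. ?\<Gamma> l j k y * (if k = i then h y else 0)) = ?\<Gamma> l j i y * h y"
      by (simp add: if_distrib[of "\<lambda>t. _ * t"] cong: if_cong)
    also have "(\<Sum>k\<in>UNIV. ?\<Gamma> l j k y * (\<Sum>m\<in>UNIV. ?\<Gamma> k i m y * p y $ m))
        = (\<Sum>k\<in>UNIV. (\<Sum>m\<in>UNIV. ?\<Gamma> l j m y * ?\<Gamma> m i k y) * p y $ k)"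
      unfolding sum_distrib_left sum_distrib_right by (subst sum.swap) (simp add: mult.assoc)
    finally show ?thesis by simp
  qed
  have R: "(\<Sum>k\<in>UNIV. riemann G l k i j y * p y $ k) =
      (\<Sum>k\<in>UNIV. partial i (?\<Gamma> l j k) y * p y $ k) - (\<Sum>k\<in>UNIV. partial j (?\<Gamma> l i k) y * p y $ k)
      + (\<Sum>k\<in>UNIV. (\<Sum>m\<in>UNIV. ?\<Gamma> l i m y * ?\<Gamma> m j k y) * p y $ k)
      - (\<Sum>k\<in>UNIV. (\<Sum>m\<in>UNIV. ?\<Gamma> l j m y * ?\<Gamma> m i k y) * p y $ k)"
    by (simp add: riemann_def sum.distrib sum_subtractf algebra_simps)
  show ?thesis
    unfolding R using E[of i j] E[of j i] partials_commute[OF open_S smooth_p y, of i j l]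
      christoffel_sym[OF y, of l i j] by (simp add: algebra_simps)
qed

end

lemma riemann_antisym: "riemann G l k i j y = - riemann G l k j i y"
  by (simp add: riemann_def sum_subtractf)

text \<open>On a surface the curvature is determined by the endomorphism \<open>R(\<partial>\<^sub>1, \<partial>\<^sub>2)\<close>, which is antisymmetric with
respect to \<open>G\<close> and hence has one degree of freedom. Its value on a single nonzero vector therefore
determines it, and the value on \<open>p\<close> is known. The hypothesis on \<open>h\<close> reads \<open>dh = - C G(p, \<cdot>)\<close>, which is
what \<open>R(X, Y) p = C (G(Y, p) X - G(X, p) Y)\<close> requires.\<close>

lemma surface_riemann:
  fixes S :: "(real ^ 2) set"
  assumes "closed_conformal_field S G p h" and y: "y \<in> S"
    and dh: "\<And>i. partial i h y = - C * (\<Sum>k\<in>UNIV. G y $ i $ k * p y $ k)"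
    and "p y \<noteq> 0"
  shows "riemann G l k i j y =
    C * ((if l = i then G y $ j $ k else 0) - (if l = j then G y $ i $ k else 0))"
proof -
  interpret closed_conformal_field S G p h by fact
  \<comment> \<open>The matrix of \<open>R(\<partial>\<^sub>1, \<partial>\<^sub>2)\<close>, with its first index up (\<open>r\<close>) and down (\<open>a\<close>).\<close>
  define r where "r l k = riemann G l k 1 2 y" for l k
  define a where "a l k = G y $ l $ 1 * r 1 k + G y $ l $ 2 * r 2 k" for l k
  define \<delta> where "\<delta> = G y $ 1 $ 1 * G y $ 2 $ 2 - G y $ 1 $ 2 * G y $ 1 $ 2"
  have G21: "G y $ 2 $ 1 = G y $ 1 $ 2" by (rule sym[OF y])
  have "a l k = - a k l" for l k
    using lowered_riemann_antisym[OF y, of l k 1 2] by (simp add: a_def r_def sum_2)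
  from this[of 1 1] this[of 2 2] this[of 2 1]
  have a: "a 1 1 = 0" "a 2 2 = 0" "a 2 1 = - a 1 2" by auto
  have f1: "r 1 1 * p y $ 1 + r 1 2 * p y $ 2 = C * (G y $ 1 $ 2 * p y $ 1 + G y $ 2 $ 2 * p y $ 2)"
    using riemann_field[OF y, of 1 1 2] unfolding dh by (simp add: r_def sum_2 G21 algebra_simps)
  have f2: "r 2 1 * p y $ 1 + r 2 2 * p y $ 2 = - C * (G y $ 1 $ 1 * p y $ 1 + G y $ 1 $ 2 * p y $ 2)"
    using riemann_field[OF y, of 2 1 2] unfolding dh by (simp add: r_def sum_2 G21 algebra_simps)
  have "a 1 1 * p y $ 1 + a 1 2 * p y $ 2 =
      G y $ 1 $ 1 * (r 1 1 * p y $ 1 + r 1 2 * p y $ 2)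
      + G y $ 1 $ 2 * (r 2 1 * p y $ 1 + r 2 2 * p y $ 2)"
    by (simp add: a_def algebra_simps)
  then have p2: "a 1 2 * p y $ 2 = C * \<delta> * p y $ 2"
    unfolding f1 f2 a \<delta>_def by (simp add: algebra_simps)
  have "a 2 1 * p y $ 1 + a 2 2 * p y $ 2 =
      G y $ 1 $ 2 * (r 1 1 * p y $ 1 + r 1 2 * p y $ 2)
      + G y $ 2 $ 2 * (r 2 1 * p y $ 1 + r 2 2 * p y $ 2)"
    by (simp add: a_def G21 algebra_simps)
  then have p1: "a 1 2 * p y $ 1 = C * \<delta> * p y $ 1"
    unfolding f1 f2 a \<delta>_def by (simp add: algebra_simps)
  have "p y $ 1 \<noteq> 0 \<or> p y $ 2 \<noteq> 0"
    using \<open>p y \<noteq> 0\<close> by (auto simp: vec_eq_iff forall_2)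
  then have a12: "a 1 2 = C * \<delta>" using p1 p2 by auto
  have R12: "r l k = C * ((if l = 1 then G y $ 2 $ k else 0) - (if l = 2 then G y $ 1 $ k else 0))"
    for l k
  proof -
    define x :: "real ^ 2" where "x = (\<chi> l. r l k
      - C * ((if l = 1 then G y $ 2 $ k else 0) - (if l = 2 then G y $ 1 $ k else 0)))"
    have "(G y *v x) $ q = a q k - C * (G y $ q $ 1 * G y $ 2 $ k - G y $ q $ 2 * G y $ 1 $ k)" for q
      by (simp add: matrix_vector_mult_def x_def sum_2 a_def algebra_simps)
    moreover have "a q k = C * (G y $ q $ 1 * G y $ 2 $ k - G y $ q $ 2 * G y $ 1 $ k)" for q
      using exhaust_2[of q] exhaust_2[of k] a a12 by (auto simp: \<delta>_def G21 algebra_simps)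
    ultimately have "G y *v x = 0" by (subst vec_eq_iff) simp
    from mult_metric_eq_0[OF y this] have "x $ l = 0" by simp
    then show ?thesis by (simp add: x_def)
  qed
  have diag: "riemann G l k i i y = 0" for l k i
    using riemann_antisym[of G l k i i y] by simp
  show ?thesis
    using exhaust_2[of i] exhaust_2[of j] R12[of l k] riemann_antisym[of G l k 2 1 y]
    by (auto simp: r_def diag)
qed


section \<open>Rescaling the metric of a homogeneous pair\<close>

lemma local_metric_scale:
  assumes "local_metric S G" and "smooth_on S c" and "\<And>y. y \<in> S \<Longrightarrow> c y \<noteq> 0"
  shows "local_metric S (\<lambda>y. c y *\<^sub>R G y)"
proof -
  interpret local_metric S G by fact
  show ?thesis
  proof
    show "invertible (c y *\<^sub>R G y)" if "y \<in> S" for y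
      by (rule scalar_invertible[OF assms(3) nondegenerate]) (rule that)+
  qed (use open_S smooth_on_scaleR[OF open_S assms(2) smooth_G] sym in auto)
qed

text \<open>For \<open>h = (\<alpha>/2) (1 + r v'/v)\<close>, the conformal factor of the generator with respect to \<open>v(f) g\<close>, the
equation \<open>h' = - C v\<close> expresses that on a surface this metric has curvature \<open>C\<close>. Keeping \<open>h\<close> as a second unknown
turns it into a first-order system for \<open>(v, h)\<close>.\<close>

definition curvature_profile ::
  "real \<Rightarrow> real \<Rightarrow> real set \<Rightarrow> (real \<Rightarrow> real) \<Rightarrow> (real \<Rightarrow> real) \<Rightarrow> bool" where
  "curvature_profile \<alpha> C T v h \<longleftrightarrow> open T \<and> T \<subseteq> {0<..} \<and>
     (\<forall>r\<in>T. v r \<noteq> 0 \<and>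
        (v has_real_derivative v r * (2 * h r / \<alpha> - 1) / r) (at r) \<and>
        (h has_real_derivative - C * v r) (at r))"

text \<open>The derivatives of \<open>v\<close> and \<open>h\<close> are smooth functions of \<open>v\<close>, \<open>h\<close> and \<open>r\<close>, so each degree of smoothness
gives the next one.\<close>

lemma curvature_profile_smooth:
  assumes "curvature_profile \<alpha> C T v h"
  shows "smooth_on T v" "smooth_on T h"
proof -
  have T: "open T" and pos: "\<And>r. r \<in> T \<Longrightarrow> r \<noteq> 0"
    and "\<And>r. r \<in> T \<Longrightarrow> (v has_real_derivative v r * (2 / \<alpha> * h r + - 1) * inverse r) (at r)"
    and "\<And>r. r \<in> T \<Longrightarrow> (h has_real_derivative - C * v r) (at r)"
    using assms unfolding curvature_profile_def by (auto simp: divide_inverse ac_simps)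
  then have
    dv: "\<And>r. r \<in> T \<Longrightarrow> (v has_derivative (\<lambda>u. v r * (2 / \<alpha> * h r + - 1) * inverse r * u)) (at r)"
    and dh: "\<And>r. r \<in> T \<Longrightarrow> (h has_derivative (\<lambda>u. - C * v r * u)) (at r)"
    unfolding has_field_derivative_def by blast+
  have id: "Ck_on k T (\<lambda>r. r)" for k
    by (cases k) (auto intro: Ck_on_const)
  have "Ck_on k T v \<and> Ck_on k T h" for k
  proof (induction k)
    case 0
    show ?case
      using dv dh by (auto intro!: continuous_at_imp_continuous_on dest: has_derivative_continuous)
  next
    case (Suc k)
    have "Ck_on k T (\<lambda>r. v r * (2 / \<alpha> * h r + - 1) * inverse r * u)" "Ck_on k T (\<lambda>r. - C * v r * u)" for u
      using Suc by (intro Ck_on_mult Ck_on_add Ck_on_const Ck_on_inverse T pos id; simp)+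
    then show ?case using Ck_on_SucI[OF T dv] Ck_on_SucI[OF T dh] by blast
  qed
  then show "smooth_on T v" "smooth_on T h" by (auto simp: smooth_on_def)
qed

text \<open>A homogeneous pair in a chart, with the action replaced by its generator \<open>p\<close>: \<open>G(p, \<cdot>) = dF\<close>,
\<open>p F = \<alpha> F\<close> and \<open>L\<^sub>p G = \<alpha> G\<close>.\<close>

locale homogeneous_local_metric = local_metric S G
  for S :: "(real ^ 'n::finite) set" and G :: "real ^ 'n \<Rightarrow> real ^ 'n ^ 'n" +
  fixes p :: "real ^ 'n \<Rightarrow> real ^ 'n" and F :: "real ^ 'n \<Rightarrow> real" and \<alpha> :: real
  assumes degree: "\<alpha> \<noteq> 0"
    and smooth_F: "smooth_on S F"
    and gradient: "y \<in> S \<Longrightarrow> (\<Sum>k\<in>UNIV. G y $ i $ k * p y $ k) = partial i F y"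
    and euler: "y \<in> S \<Longrightarrow> (\<Sum>k\<in>UNIV. partial k F y * p y $ k) = \<alpha> * F y"
    and lie_derivative: "y \<in> S \<Longrightarrow>
      (\<Sum>k\<in>UNIV. partial k (\<lambda>z. G z $ i $ j) y * p y $ k
         + G y $ k $ j * partial i (\<lambda>z. p z $ k) y
         + G y $ i $ k * partial j (\<lambda>z. p z $ k) y) = \<alpha> * G y $ i $ j"
begin

lemma subset:
  assumes "open S'" "S' \<subseteq> S"
  shows "homogeneous_local_metric S' G p F \<alpha>"
  by unfold_locales
    (use assms smooth_G smooth_F sym nondegenerate degree gradient euler lie_derivative in
      \<open>auto intro: smooth_on_subset\<close>)

text \<open>The generator is the gradient \<open>G\<^sup>-\<^sup>1 dF\<close>.\<close>

lemma smooth_field: "smooth_on S (\<lambda>y. p y $ k)"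
proof -
  have smooth: "smooth_on S (\<lambda>y. \<Sum>i\<in>UNIV. matrix_inv (G y) $ k $ i * partial i F y)"
    by (intro smooth_on_sum smooth_on_mult smooth_on_matrix_inv_entry open_S smooth_entry
        nondegenerate smooth_on_partial smooth_F)
  have eq: "(\<Sum>i\<in>UNIV. matrix_inv (G y) $ k $ i * partial i F y) = p y $ k" if y: "y \<in> S" for y
  proof -
    have "G y *v p y = (\<chi> i. partial i F y)"
      unfolding matrix_vector_mult_def using gradient[OF y] by simp
    moreover have "matrix_inv (G y) ** G y = mat 1"
      using matrix_inv_right[OF nondegenerate[OF y]] matrix_left_right_inverse by blast
    ultimately have "matrix_inv (G y) *v (\<chi> i. partial i F y) = p y"
      using matrix_vector_mul_assoc[of "matrix_inv (G y)" "G y" "p y"] by simp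
    then have "(matrix_inv (G y) *v (\<chi> i. partial i F y)) $ k = p y $ k" by simp
    then show ?thesis by (simp add: matrix_vector_mult_def)
  qed
  show ?thesis by (rule smooth_on_cong[OF open_S eq smooth])
qed

text \<open>The 1-form \<open>v(F) G(p, \<cdot>) = v(F) dF\<close> is closed because it is a function of \<open>F\<close> times \<open>dF\<close>, and
\<open>L\<^sub>p (v(F) G) = (v'(F) \<alpha> F + \<alpha> v(F)) G\<close> is \<open>2 h(F) v(F) G\<close> by the equation for \<open>v'\<close>.\<close>

lemma closed_conformal_field_rescaled:
  assumes prof: "curvature_profile \<alpha> C T v h" and FT: "F ` S \<subseteq> T"
  shows "closed_conformal_field S (\<lambda>y. v (F y) *\<^sub>R G y) p (\<lambda>y. h (F y))"
proof -
  have dF: "F differentiable (at y)" if "y \<in> S" for y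
    by (rule smooth_on_differentiable[OF smooth_F that])
  have dv: "(v has_real_derivative v (F y) * (2 * h (F y) / \<alpha> - 1) / F y) (at (F y))"
    and nz: "F y \<noteq> 0" "v (F y) \<noteq> 0" if "y \<in> S" for y
    using prof FT that unfolding curvature_profile_def by force+
  note smooth_vF = smooth_on_compose_real[OF open_S FT curvature_profile_smooth(1)[OF prof] smooth_F]
  have metric: "local_metric S (\<lambda>y. v (F y) *\<^sub>R G y)"
    by (rule local_metric_scale[OF local_metric_axioms smooth_vF nz(2)])
  have grad: "partial i (\<lambda>z. \<Sum>k\<in>UNIV. (v (F z) *\<^sub>R G z) $ j $ k * p z $ k) y =
      v (F y) * (2 * h (F y) / \<alpha> - 1) / F y * partial i F y * partial j F y
      + v (F y) * partial i (partial j F) y" if y: "y \<in> S" for i j y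
  proof -
    have "partial i (\<lambda>z. \<Sum>k\<in>UNIV. (v (F z) *\<^sub>R G z) $ j $ k * p z $ k) y =
        partial i (\<lambda>z. v (F z) * partial j F z) y"
    proof (rule partial_cong[OF open_S y, symmetric])
      show "v (F z) * partial j F z = (\<Sum>k\<in>UNIV. (v (F z) *\<^sub>R G z) $ j $ k * p z $ k)"
        if "z \<in> S" for z
        unfolding gradient[OF that, symmetric] sum_distrib_left by (simp add: mult.assoc)
    qed (intro differentiable_mult smooth_on_differentiable[OF _ y] smooth_vF smooth_on_partial smooth_F)
    also have "\<dots> = partial i (\<lambda>z. v (F z)) y * partial j F y + v (F y) * partial i (partial j F) y"
      by (intro partial_mult smooth_on_differentiable[OF _ y] smooth_vF smooth_on_partial smooth_F)
    finally show ?thesis by (simp add: partial_compose[OF dv[OF y] dF[OF y]])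
  qed
  show ?thesis
  proof (intro closed_conformal_field.intro metric closed_conformal_field_axioms.intro)
    show "smooth_on S (\<lambda>y. p y $ k)" for k by (rule smooth_field)
    show "smooth_on S (\<lambda>y. h (F y))"
      by (rule smooth_on_compose_real[OF open_S FT curvature_profile_smooth(2)[OF prof] smooth_F])
    fix y i j assume y: "y \<in> S"
    show "partial i (\<lambda>z. \<Sum>k\<in>UNIV. (v (F z) *\<^sub>R G z) $ j $ k * p z $ k) y =
        partial j (\<lambda>z. \<Sum>k\<in>UNIV. (v (F z) *\<^sub>R G z) $ i $ k * p z $ k) y"
      unfolding grad[OF y] partials_commute[OF open_S smooth_F y, of i j] by simp
    have "partial k (\<lambda>z. (v (F z) *\<^sub>R G z) $ i $ j) y =
        v (F y) * (2 * h (F y) / \<alpha> - 1) / F y * partial k F y * G y $ i $ j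
        + v (F y) * partial k (\<lambda>z. G z $ i $ j) y" for k
      by (simp add: partial_mult smooth_on_differentiable[OF smooth_vF y] diff_entry y
          partial_compose[OF dv[OF y] dF[OF y]])
    then have "(\<Sum>k\<in>UNIV. partial k (\<lambda>z. (v (F z) *\<^sub>R G z) $ i $ j) y * p y $ k
         + (v (F y) *\<^sub>R G y) $ k $ j * partial i (\<lambda>z. p z $ k) y
         + (v (F y) *\<^sub>R G y) $ i $ k * partial j (\<lambda>z. p z $ k) y)
      = (\<Sum>k\<in>UNIV. v (F y) * (2 * h (F y) / \<alpha> - 1) / F y * G y $ i $ j * (partial k F y * p y $ k)
         + v (F y) * (partial k (\<lambda>z. G z $ i $ j) y * p y $ k
         + G y $ k $ j * partial i (\<lambda>z. p z $ k) y
         + G y $ i $ k * partial j (\<lambda>z. p z $ k) y))"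
      by (intro sum.cong refl) (simp add: algebra_simps)
    also have "\<dots> = v (F y) * (2 * h (F y) / \<alpha> - 1) / F y * G y $ i $ j * (\<alpha> * F y)
        + v (F y) * (\<alpha> * G y $ i $ j)"
      by (simp only: sum.distrib[of "\<lambda>k. _ * (partial k F y * _ k)"] sum_distrib_left[symmetric]
          euler[OF y] lie_derivative[OF y])
    also have "\<dots> = 2 * h (F y) * (v (F y) *\<^sub>R G y) $ i $ j"
      using nz[OF y] degree by (simp add: field_simps)
    finally show "(\<Sum>k\<in>UNIV. partial k (\<lambda>z. (v (F z) *\<^sub>R G z) $ i $ j) y * p y $ k
         + (v (F y) *\<^sub>R G y) $ k $ j * partial i (\<lambda>z. p z $ k) y
         + (v (F y) *\<^sub>R G y) $ i $ k * partial j (\<lambda>z. p z $ k) y)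
      = 2 * h (F y) * (v (F y) *\<^sub>R G y) $ i $ j" .
  qed
qed

end

lemma rescaled_surface_riemann:
  fixes S :: "(real ^ 2) set"
  assumes "homogeneous_local_metric S G p F \<alpha>"
    and prof: "curvature_profile \<alpha> C T v h" and FT: "F ` S \<subseteq> T" and y: "y \<in> S"
  shows "riemann (\<lambda>y. v (F y) *\<^sub>R G y) l k i j y = C * ((if l = i then v (F y) * G y $ j $ k else 0)
    - (if l = j then v (F y) * G y $ i $ k else 0))"
proof -
  interpret homogeneous_local_metric S G p F \<alpha> by fact
  have dh: "(h has_real_derivative - C * v (F y)) (at (F y))" and "F y > 0"
    using prof FT y unfolding curvature_profile_def by force+
  have "partial i (\<lambda>y. h (F y)) y = - C * (\<Sum>k\<in>UNIV. (v (F y) *\<^sub>R G y) $ i $ k * p y $ k)" for i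
    using gradient[OF y, of i]
    by (simp add: partial_compose[OF dh smooth_on_differentiable[OF smooth_F y]] mult.assoc
        sum_distrib_left[symmetric])
  moreover have "p y \<noteq> 0"
    using euler[OF y] degree \<open>F y > 0\<close> by auto
  ultimately show ?thesis
    using surface_riemann[OF closed_conformal_field_rescaled[OF prof FT] y, of C l k i j] by simp
qed


section \<open>Solutions of the curvature equation\<close>

text \<open>In terms of \<open>W = r v\<close> and its logarithmic derivative \<open>k\<close> with respect to \<open>log r\<close>, one has
\<open>h = \<alpha> k / 2\<close>, and the curvature equation becomes \<open>dk / d(log r) = - 2 (C / \<alpha>) W\<close>.\<close>

lemma curvature_profile_of_log_derivative:
  assumes "open T" "T \<subseteq> {0<..}" "\<alpha> \<noteq> 0"
    and W: "\<And>r. r \<in> T \<Longrightarrow> W r \<noteq> 0"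
    and dW: "\<And>r. r \<in> T \<Longrightarrow> (W has_real_derivative W r * k r / r) (at r)"
    and dk: "\<And>r. r \<in> T \<Longrightarrow> (k has_real_derivative - 2 * (C / \<alpha>) * W r / r) (at r)"
    and v: "\<And>r. r \<in> T \<Longrightarrow> v r = W r / r"
  shows "curvature_profile \<alpha> C T v (\<lambda>r. \<alpha> * k r / 2)"
  unfolding curvature_profile_def
proof (intro conjI ballI assms)
  fix r assume r: "r \<in> T"
  with assms(2) have "r > 0" by auto
  show "v r \<noteq> 0" using W[OF r] v[OF r] \<open>r > 0\<close> by simp
  have "((\<lambda>r. W r / r) has_real_derivative (W r / r) * (k r - 1) / r) (at r)"
    using \<open>r > 0\<close> by (auto intro!: derivative_eq_intros dW[OF r] simp: field_simps)
  then have "((\<lambda>r. W r / r) has_real_derivative v r * (2 * (\<alpha> * k r / 2) / \<alpha> - 1) / r) (at r)"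
    using \<open>\<alpha> \<noteq> 0\<close> by (simp add: v[OF r])
  then show "(v has_real_derivative v r * (2 * (\<alpha> * k r / 2) / \<alpha> - 1) / r) (at r)"
    by (rule has_field_derivative_transform_within_open[OF _ \<open>open T\<close> r]) (simp add: v)
  show "((\<lambda>r. \<alpha> * k r / 2) has_real_derivative - C * v r) (at r)"
    using \<open>r > 0\<close> \<open>\<alpha> \<noteq> 0\<close>
    by (auto intro!: derivative_eq_intros dk[OF r] simp: v[OF r] field_simps)
qed

lemma w_domain_subset: "w_domain s C1 C2 \<subseteq> {0<..}"
  by (auto simp: w_domain_def)

lemma open_w_domain: "open (w_domain s C1 C2)"
proof -
  \<comment> \<open>The domain is where this function, continuous on the positive reals, does not vanish.\<close>
  define \<phi> :: "real \<Rightarrow> real" where "\<phi> r = (if s < 0 \<and> C1 < 0 then sin (sqrt (- C1) * (ln r + C2))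
    else if s < 0 \<and> C1 = 0 then ln r + C2 else 1)" for r
  have "continuous_on {0<..} \<phi>"
    by (cases "s < 0"; cases "C1 < 0"; cases "C1 = 0")
      (auto simp: \<phi>_def[abs_def] intro!: continuous_intros)
  then have "open ({0<..} \<inter> \<phi> -` (- {0}))"
    by (rule continuous_open_preimage) auto
  moreover have "{0<..} \<inter> \<phi> -` (- {0}) = w_domain s C1 C2"
    by (auto simp: w_domain_def \<phi>_def split: if_splits)
  ultimately show ?thesis by simp
qed

text \<open>The logarithmic derivatives are \<open>- 2 c tanh\<close>, the constant exponent, \<open>- 2 c cot\<close> and \<open>- 2 / (log r + C2)\<close>
in the four cases, where \<open>c\<close> is the square root of \<open>\<bar>C1\<bar>\<close>.\<close>

lemma w_log_derivative:
  assumes "(s, C1, C2) \<in> Delta1 \<union> Delta2 \<union> Delta3" and \<sigma>: "\<sigma> \<in> {1, -1}"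
  obtains k where "\<And>r. r \<in> w_domain s C1 C2 \<Longrightarrow> w \<sigma> s C1 C2 r \<noteq> 0"
    and "\<And>r. r \<in> w_domain s C1 C2 \<Longrightarrow>
      (w \<sigma> s C1 C2 has_real_derivative w \<sigma> s C1 C2 r * k r / r) (at r)"
    and "\<And>r. r \<in> w_domain s C1 C2 \<Longrightarrow>
      (k has_real_derivative - 2 * s * w \<sigma> s C1 C2 r / r) (at r)"
proof -
  consider (pos) "s > 0" "C1 > 0" | (zero) "s = 0" "C1 \<ge> 0" | (neg) "s < 0" "C1 < 0"
    | (double) "s < 0" "C1 = 0"
    using assms(1) by (force simp: Delta1_def Delta2_def Delta3_def)
  then show thesis
  proof cases
    case pos
    define c where "c = sqrt C1"
    have c: "C1 = c\<^sup>2" "c > 0" using pos by (auto simp: c_def)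
    have w: "w \<sigma> s C1 C2 = (\<lambda>r. c\<^sup>2 / (s * (cosh (c * (ln r + C2)))\<^sup>2))"
      using pos by (simp add: w_def fun_eq_iff c_def)
    have ch: "cosh x \<noteq> 0" for x :: real using cosh_real_pos[of x] by simp
    show thesis
    proof (rule that[of "\<lambda>r. - 2 * c * (sinh (c * (ln r + C2)) / cosh (c * (ln r + C2)))"])
      fix r assume "r \<in> w_domain s C1 C2"
      then have r: "r > 0" by (simp add: w_domain_def)
      show "w \<sigma> s C1 C2 r \<noteq> 0" unfolding w using pos c ch by simp
      show "(w \<sigma> s C1 C2 has_real_derivative w \<sigma> s C1 C2 r *
          (- 2 * c * (sinh (c * (ln r + C2)) / cosh (c * (ln r + C2)))) / r) (at r)"
        unfolding w using r pos ch c
        by (auto intro!: derivative_eq_intros simp: field_simps power2_eq_square)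
      have sq: "sinh x * sinh x = cosh x * cosh x - 1" for x :: real
        using cosh_square_eq[of x] by (simp add: power2_eq_square)
      show "((\<lambda>r. - 2 * c * (sinh (c * (ln r + C2)) / cosh (c * (ln r + C2))))
          has_real_derivative - 2 * s * w \<sigma> s C1 C2 r / r) (at r)"
        unfolding w using r pos ch c
        by (auto intro!: derivative_eq_intros simp: field_simps power2_eq_square sq)
    qed
  next
    case zero
    have w: "w \<sigma> s C1 C2 = (\<lambda>r. exp C2 * r powr (\<sigma> * 2 * sqrt C1))"
      using zero by (simp add: w_def fun_eq_iff)
    show thesis
    proof (rule that[of "\<lambda>_. \<sigma> * 2 * sqrt C1"])
      fix r assume "r \<in> w_domain s C1 C2"
      then have r: "r > 0" by (simp add: w_domain_def)
      show "w \<sigma> s C1 C2 r \<noteq> 0" using r by (simp add: w)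
      show "(w \<sigma> s C1 C2 has_real_derivative w \<sigma> s C1 C2 r * (\<sigma> * 2 * sqrt C1) / r) (at r)"
        unfolding w using r by (auto intro!: derivative_eq_intros simp: powr_diff field_simps)
      show "((\<lambda>_. \<sigma> * 2 * sqrt C1) has_real_derivative - 2 * s * w \<sigma> s C1 C2 r / r) (at r)"
        using zero by simp
    qed
  next
    case neg
    define c where "c = sqrt (- C1)"
    have c: "C1 = - c\<^sup>2" "c > 0" using neg by (auto simp: c_def)
    have w: "w \<sigma> s C1 C2 = (\<lambda>r. - c\<^sup>2 / (s * (sin (c * (ln r + C2)))\<^sup>2))"
      using neg by (simp add: w_def fun_eq_iff c_def)
    show thesis
    proof (rule that[of "\<lambda>r. - 2 * c * (cos (c * (ln r + C2)) / sin (c * (ln r + C2)))"])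
      fix r assume "r \<in> w_domain s C1 C2"
      then have r: "r > 0" and sn: "sin (c * (ln r + C2)) \<noteq> 0"
        using neg by (auto simp: w_domain_def c_def)
      show "w \<sigma> s C1 C2 r \<noteq> 0" unfolding w using neg c sn by simp
      show "(w \<sigma> s C1 C2 has_real_derivative w \<sigma> s C1 C2 r *
          (- 2 * c * (cos (c * (ln r + C2)) / sin (c * (ln r + C2)))) / r) (at r)"
        unfolding w using r neg sn c
        by (auto intro!: derivative_eq_intros simp: field_simps power2_eq_square)
      have sq: "cos x * cos x = 1 - sin x * sin x" for x :: real
        using sin_cos_squared_add[of x] by (simp add: power2_eq_square)
      show "((\<lambda>r. - 2 * c * (cos (c * (ln r + C2)) / sin (c * (ln r + C2))))
          has_real_derivative - 2 * s * w \<sigma> s C1 C2 r / r) (at r)"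
        unfolding w using r neg sn c
        by (auto intro!: derivative_eq_intros simp: field_simps power2_eq_square sq)
    qed
  next
    case double
    have w: "w \<sigma> s C1 C2 = (\<lambda>r. - 1 / (s * (ln r + C2)\<^sup>2))"
      using double by (simp add: w_def fun_eq_iff)
    show thesis
    proof (rule that[of "\<lambda>r. - 2 / (ln r + C2)"])
      fix r assume "r \<in> w_domain s C1 C2"
      then have r: "r > 0" and nz: "ln r + C2 \<noteq> 0"
        using double by (auto simp: w_domain_def)
      show "w \<sigma> s C1 C2 r \<noteq> 0" unfolding w using double nz by simp
      show "(w \<sigma> s C1 C2 has_real_derivative w \<sigma> s C1 C2 r * (- 2 / (ln r + C2)) / r) (at r)"
        unfolding w using r double nz
        by (auto intro!: derivative_eq_intros simp: divide_simps power2_eq_square)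
      show "((\<lambda>r. - 2 / (ln r + C2)) has_real_derivative - 2 * s * w \<sigma> s C1 C2 r / r) (at r)"
        unfolding w using r double nz
        by (auto intro!: derivative_eq_intros simp: divide_simps power2_eq_square)
    qed
  qed
qed

lemma w_curvature_profile:
  assumes "\<alpha> \<noteq> 0" and "(C / \<alpha>, C1, C2) \<in> Delta1 \<union> Delta2 \<union> Delta3" and "\<sigma> \<in> {1, -1}"
    and v: "\<And>r. r \<in> w_domain (C / \<alpha>) C1 C2 \<Longrightarrow> v r = 1 / r * w \<sigma> (C / \<alpha>) C1 C2 r"
  obtains h where "curvature_profile \<alpha> C (w_domain (C / \<alpha>) C1 C2) v h"
proof (rule w_log_derivative[OF assms(2,3)])
  fix k
  assume "\<And>r. r \<in> w_domain (C / \<alpha>) C1 C2 \<Longrightarrow> w \<sigma> (C / \<alpha>) C1 C2 r \<noteq> 0"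
    and "\<And>r. r \<in> w_domain (C / \<alpha>) C1 C2 \<Longrightarrow>
      (w \<sigma> (C / \<alpha>) C1 C2 has_real_derivative w \<sigma> (C / \<alpha>) C1 C2 r * k r / r) (at r)"
    and "\<And>r. r \<in> w_domain (C / \<alpha>) C1 C2 \<Longrightarrow>
      (k has_real_derivative - 2 * (C / \<alpha>) * w \<sigma> (C / \<alpha>) C1 C2 r / r) (at r)"
  from curvature_profile_of_log_derivative[OF open_w_domain w_domain_subset assms(1) this, where v = v] v
  show thesis by (intro that) simp
qed

lemma powr_curvature_profile:
  assumes "\<alpha> \<noteq> 0"
  shows "curvature_profile \<alpha> 0 {0<..} (\<lambda>r. r powr \<beta>) (\<lambda>r. \<alpha> * (\<beta> + 1) / 2)"
proof (rule curvature_profile_of_log_derivative[where W = "\<lambda>r. r powr (\<beta> + 1)"])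
  show "((\<lambda>r. r powr (\<beta> + 1)) has_real_derivative r powr (\<beta> + 1) * (\<beta> + 1) / r) (at r)"
    if "r \<in> {0<..}" for r
    using that by (intro DERIV_cong[OF has_real_derivative_powr]) (auto simp: powr_add)
qed (use assms in \<open>auto simp: powr_add\<close>)


section \<open>Tangent vectors and metrics in charts\<close>

locale smooth_manifold =
  fixes A :: "('a::{t2_space, second_countable_topology}, 'n::finite) chart set"
  assumes atlas: "smooth_atlas A"
begin

lemma
  assumes "c \<in> A"
  shows open_chart_dom: "open (chart_dom c)"
    and open_chart_range: "open (chart_map c ` chart_dom c)"
    and chart_homeomorphism:
      "homeomorphism (chart_dom c) (chart_map c ` chart_dom c) (chart_map c) (chart_inv c)"
  using atlas assms unfolding smooth_atlas_def by blast+

lemma charts_atD: "c \<in> charts_at A x \<Longrightarrow> c \<in> A" "c \<in> charts_at A x \<Longrightarrow> x \<in> chart_dom c"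
  by (auto simp: charts_at_def)

lemma chart_inv_map: "c \<in> A \<Longrightarrow> x \<in> chart_dom c \<Longrightarrow> chart_inv c (chart_map c x) = x"
  using chart_homeomorphism homeomorphism_apply1 by blast

lemma chart_inv_map_at: "c \<in> charts_at A x \<Longrightarrow> chart_inv c (chart_map c x) = x"
  using chart_inv_map charts_atD by blast

lemma chart_map_inv:
  assumes "c \<in> A" "y \<in> chart_map c ` chart_dom c"
  shows "chart_map c (chart_inv c y) = y" "chart_inv c y \<in> chart_dom c"
  using assms chart_inv_map by auto

lemma charts_at_chart_inv:
  "c \<in> A \<Longrightarrow> y \<in> chart_map c ` chart_dom c \<Longrightarrow> c \<in> charts_at A (chart_inv c y)"
  using chart_map_inv by (simp add: charts_at_def)

lemma continuous_on_chart_inv: "c \<in> A \<Longrightarrow> continuous_on (chart_map c ` chart_dom c) (chart_inv c)"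
  using chart_homeomorphism homeomorphism_cont2 by blast

lemma continuous_on_chart_map: "c \<in> A \<Longrightarrow> continuous_on (chart_dom c) (chart_map c)"
  using chart_homeomorphism homeomorphism_cont1 by blast

lemma open_chart_image:
  assumes "c \<in> A" "open V"
  shows "open (chart_map c ` (chart_dom c \<inter> V))"
proof -
  have "chart_map c ` (chart_dom c \<inter> V) = chart_map c ` chart_dom c \<inter> chart_inv c -` V"
    using chart_inv_map[OF assms(1)] by force
  then show ?thesis
    using continuous_open_preimage[OF continuous_on_chart_inv open_chart_range] assms by simp
qed

lemma some_chart_at: "some_chart A x \<in> charts_at A x"
proof -
  have "\<exists>c. c \<in> charts_at A x"
    using atlas unfolding smooth_atlas_def charts_at_def by blast
  then show ?thesis unfolding some_chart_def by (rule someI_ex)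
qed

definition jacobian :: "('a, 'n) chart \<Rightarrow> ('a, 'n) chart \<Rightarrow> 'a \<Rightarrow> real ^ 'n \<Rightarrow> real ^ 'n" where
  "jacobian c d x = frechet_derivative (chart_map d \<circ> chart_inv c) (at (chart_map c x))"

lemma transition_has_derivative:
  assumes "c \<in> charts_at A x" "d \<in> charts_at A x"
  shows "((chart_map d \<circ> chart_inv c) has_derivative jacobian c d x) (at (chart_map c x))"
  unfolding jacobian_def
proof (rule smooth_on_has_derivative)
  show "smooth_on (chart_map c ` (chart_dom c \<inter> chart_dom d)) (chart_map d \<circ> chart_inv c)"
    using atlas assms unfolding smooth_atlas_def by (blast dest: charts_atD)
qed (use assms charts_atD in auto)

text \<open>The chain rule across two charts; that the definitions of the differential, of the tangent map and
of tangent vectors do not depend on the chosen chart comes down to it.\<close>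

lemma derivative_change_chart:
  assumes c: "c \<in> charts_at A x" and d: "d \<in> charts_at A x"
    and D: "((h \<circ> chart_inv d) has_derivative D) (at (chart_map d x))"
  shows "((h \<circ> chart_inv c) has_derivative (\<lambda>u. D (jacobian c d x u))) (at (chart_map c x))"
proof -
  have cA: "c \<in> A" and dA: "d \<in> A" and x: "x \<in> chart_dom c \<inter> chart_dom d"
    using c d charts_atD by auto
  have "((\<lambda>z. (h \<circ> chart_inv d) ((chart_map d \<circ> chart_inv c) z)) has_derivative
      (\<lambda>u. D (jacobian c d x u))) (at (chart_map c x))"
    by (rule has_derivative_compose[OF transition_has_derivative[OF c d]])
      (simp add: chart_inv_map_at[OF c] D[unfolded o_def] o_def)
  then show ?thesis
  proof (rule has_derivative_transform_within_open)
    show "open (chart_map c ` (chart_dom c \<inter> chart_dom d))"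
      by (rule open_chart_image[OF cA open_chart_dom[OF dA]])
    show "chart_map c x \<in> chart_map c ` (chart_dom c \<inter> chart_dom d)" using x by blast
    show "(h \<circ> chart_inv d) ((chart_map d \<circ> chart_inv c) z) = (h \<circ> chart_inv c) z"
      if "z \<in> chart_map c ` (chart_dom c \<inter> chart_dom d)" for z
      using that chart_inv_map[OF cA] chart_inv_map[OF dA] by auto
  qed
qed

lemma jacobian_chain:
  assumes "c \<in> charts_at A x" "d \<in> charts_at A x" "e \<in> charts_at A x"
  shows "jacobian c e x u = jacobian d e x (jacobian c d x u)"
  using has_derivative_unique[OF transition_has_derivative[OF assms(1,3)]
      derivative_change_chart[OF assms(1,2) transition_has_derivative[OF assms(2,3)]]]
  by meson

lemma jacobian_self:
  assumes c: "c \<in> charts_at A x"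
  shows "jacobian c c x u = u"
proof -
  have "((\<lambda>z. z) has_derivative jacobian c c x) (at (chart_map c x))"
    by (rule has_derivative_transform_within_open[OF transition_has_derivative[OF c c]
          open_chart_range[OF charts_atD(1)[OF c]]])
      (use charts_atD[OF c] chart_map_inv in auto)
  from has_derivative_unique[OF this has_derivative_ident] show ?thesis by simp
qed

lemma linear_jacobian:
  "c \<in> charts_at A x \<Longrightarrow> d \<in> charts_at A x \<Longrightarrow> linear (jacobian c d x)"
  using has_derivative_linear transition_has_derivative by blast

lemma tangent_space_iff: "X \<in> tangent_space A x \<longleftrightarrow>
    (\<forall>c\<in>charts_at A x. \<forall>d\<in>charts_at A x. X d = jacobian c d x (X c)) \<and>
    (\<forall>c. c \<notin> charts_at A x \<longrightarrow> X c = 0)"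
  unfolding tangent_space_def jacobian_def by simp

lemma tangent_change_chart:
  "X \<in> tangent_space A x \<Longrightarrow> c \<in> charts_at A x \<Longrightarrow> d \<in> charts_at A x \<Longrightarrow>
    X d = jacobian c d x (X c)"
  using tangent_space_iff by blast

lemma tangent_outside: "X \<in> tangent_space A x \<Longrightarrow> c \<notin> charts_at A x \<Longrightarrow> X c = 0"
  using tangent_space_iff by blast

lemma tangent_spaceI:
  assumes "\<And>c d. c \<in> charts_at A x \<Longrightarrow> d \<in> charts_at A x \<Longrightarrow> X d = jacobian c d x (X c)"
    and "\<And>c. c \<notin> charts_at A x \<Longrightarrow> X c = 0"
  shows "X \<in> tangent_space A x"
  using assms tangent_space_iff by blast

lemma tangent_eqI:
  assumes "X \<in> tangent_space A x" "Y \<in> tangent_space A x" "c \<in> charts_at A x" "X c = Y c"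
  shows "X = Y"
proof
  fix d
  show "X d = Y d"
    using tangent_change_chart[OF assms(1,3), of d] tangent_change_chart[OF assms(2,3), of d]
      tangent_outside[OF assms(1), of d] tangent_outside[OF assms(2), of d] assms(4)
    by (cases "d \<in> charts_at A x") simp_all
qed

lemma coord_vector_eq: "coord_vector A c x u d = (if d \<in> charts_at A x then jacobian c d x u else 0)"
  by (simp add: coord_vector_def jacobian_def)

lemma coord_vector_tangent:
  assumes "c \<in> charts_at A x"
  shows "coord_vector A c x u \<in> tangent_space A x"
proof (rule tangent_spaceI)
  show "coord_vector A c x u e = jacobian d e x (coord_vector A c x u d)"
    if "d \<in> charts_at A x" "e \<in> charts_at A x" for d e
    using jacobian_chain[OF assms that, of u] that by (simp add: coord_vector_eq)
qed (simp add: coord_vector_eq)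

lemma coord_vector_component: "c \<in> charts_at A x \<Longrightarrow> coord_vector A c x u c = u"
  by (simp add: coord_vector_eq jacobian_self)

lemma coord_vector_tangent_eq:
  assumes "X \<in> tangent_space A x" "c \<in> charts_at A x" "X c = u"
  shows "coord_vector A c x u = X"
  using assms by (intro tangent_eqI[OF coord_vector_tangent]) (auto simp: coord_vector_component)

lemma tangent_linear_combination:
  assumes "X \<in> tangent_space A x" "Y \<in> tangent_space A x"
  shows "(\<lambda>c. a *\<^sub>R X c + b *\<^sub>R Y c) \<in> tangent_space A x"
proof -
  have "a *\<^sub>R X d + b *\<^sub>R Y d = jacobian c d x (a *\<^sub>R X c + b *\<^sub>R Y c)"
    if "c \<in> charts_at A x" "d \<in> charts_at A x" for c d
    unfolding tangent_change_chart[OF assms(1) that] tangent_change_chart[OF assms(2) that]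
      linear_add[OF linear_jacobian[OF that]] linear_scale[OF linear_jacobian[OF that]] ..
  then show ?thesis
    by (rule tangent_spaceI) (simp_all add: tangent_outside[OF assms(1)] tangent_outside[OF assms(2)])
qed

lemma tangent_zero: "(\<lambda>_. 0) \<in> tangent_space A x"
  using linear_0[OF linear_jacobian] by (intro tangent_spaceI) simp_all

lemma tangent_sum:
  assumes "\<And>i. i \<in> I \<Longrightarrow> X i \<in> tangent_space A x"
  shows "(\<lambda>c. \<Sum>i\<in>I. a i *\<^sub>R X i c) \<in> tangent_space A x"
  using assms
proof (induction I rule: infinite_finite_induct)
  case (insert i I)
  then show ?case
    using tangent_linear_combination[of "X i" x "\<lambda>c. \<Sum>i\<in>I. a i *\<^sub>R X i c" "a i" 1] by simp
qed (auto intro: tangent_zero)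

lemma differential_chart:
  assumes f: "(f \<circ> chart_inv c) differentiable (at (chart_map c x))"
    and c: "c \<in> charts_at A x" and X: "X \<in> tangent_space A x"
  shows "differential A f x X = frechet_derivative (f \<circ> chart_inv c) (at (chart_map c x)) (X c)"
proof -
  define d where "d = some_chart A x"
  have d: "d \<in> charts_at A x" by (simp add: d_def some_chart_at)
  have "((f \<circ> chart_inv d) has_derivative
     (\<lambda>u. frechet_derivative (f \<circ> chart_inv c) (at (chart_map c x)) (jacobian d c x u)))
     (at (chart_map d x))"
    by (rule derivative_change_chart[OF d c]) (use f frechet_derivative_works in blast)
  then show ?thesis
    using tangent_change_chart[OF X d c]
    by (simp add: differential_def Let_def flip: d_def frechet_derivative_at)
qed

end

locale semi_riemannian = smooth_manifold A
  for A :: "('a::{t2_space, second_countable_topology}, 'n::finite) chart set" +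
  fixes U :: "'a set" and g :: "('a, 'n) metric_field"
  assumes metric: "pseudo_riemannian_metric_on A U g"
begin

lemma open_U: "open U"
  using metric by (simp add: pseudo_riemannian_metric_on_def)

lemma metric_sym:
  "x \<in> U \<Longrightarrow> X \<in> tangent_space A x \<Longrightarrow> Y \<in> tangent_space A x \<Longrightarrow> g x X Y = g x Y X"
  using metric by (simp add: pseudo_riemannian_metric_on_def)

lemma metric_linear:
  "x \<in> U \<Longrightarrow> X \<in> tangent_space A x \<Longrightarrow> Y \<in> tangent_space A x \<Longrightarrow> Z \<in> tangent_space A x \<Longrightarrow>
    g x (\<lambda>c. a *\<^sub>R X c + b *\<^sub>R Y c) Z = a * g x X Z + b * g x Y Z"
  using metric by (simp add: pseudo_riemannian_metric_on_def)

lemma metric_nondegenerate: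
  "x \<in> U \<Longrightarrow> X \<in> tangent_space A x \<Longrightarrow> (\<And>Y. Y \<in> tangent_space A x \<Longrightarrow> g x X Y = 0) \<Longrightarrow>
    X = (\<lambda>_. 0)"
  using metric by (simp add: pseudo_riemannian_metric_on_def)

lemma metric_sum:
  assumes x: "x \<in> U" and Z: "Z \<in> tangent_space A x"
    and "\<And>i. i \<in> I \<Longrightarrow> X i \<in> tangent_space A x"
  shows "g x (\<lambda>c. \<Sum>i\<in>I. a i *\<^sub>R X i c) Z = (\<Sum>i\<in>I. a i * g x (X i) Z)"
  using assms(3)
proof (induction I rule: infinite_finite_induct)
  case (insert i I)
  then show ?case
    using metric_linear[OF x _ _ Z, of "X i" "\<lambda>c. \<Sum>i\<in>I. a i *\<^sub>R X i c" "a i" 1] tangent_sum[of I X x a]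
    by simp
qed (use metric_linear[OF x Z Z Z, of 0 0] in auto)

lemma metric_in_chart:
  assumes x: "x \<in> U" and c: "c \<in> charts_at A x"
    and X: "X \<in> tangent_space A x" and Y: "Y \<in> tangent_space A x"
  shows "g x X Y =
    (\<Sum>i\<in>UNIV. \<Sum>j\<in>UNIV. metric_matrix A g c (chart_map c x) $ i $ j * X c $ i * Y c $ j)"
proof -
  let ?E = "\<lambda>i. coord_vector A c x (axis i 1)"
  have E: "?E i \<in> tangent_space A x" for i
    by (rule coord_vector_tangent[OF c])
  have expand: "Z = (\<lambda>d. \<Sum>i\<in>UNIV. Z c $ i *\<^sub>R ?E i d)" if "Z \<in> tangent_space A x" for Z
  proof (rule tangent_eqI[OF that tangent_sum[OF E] c])
    show "Z c = (\<Sum>i\<in>UNIV. Z c $ i *\<^sub>R ?E i c)"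
      using basis_expansion[of "Z c"]
      by (simp add: scalar_mult_eq_scaleR coord_vector_component[OF c])
  qed
  have "g x X Y = (\<Sum>i\<in>UNIV. X c $ i * g x (?E i) Y)"
    by (subst expand[OF X], subst metric_sum[OF x Y E]) (rule refl)
  also have "\<dots> = (\<Sum>i\<in>UNIV. X c $ i * g x Y (?E i))"
    by (simp add: metric_sym[OF x E Y])
  also have "\<dots> = (\<Sum>i\<in>UNIV. X c $ i * (\<Sum>j\<in>UNIV. Y c $ j * g x (?E j) (?E i)))"
    by (subst expand[OF Y], subst metric_sum[OF x E E]) (rule refl)
  finally show ?thesis
    by (simp add: metric_matrix_def chart_inv_map_at[OF c] sum_distrib_left metric_sym[OF x E E]
        ac_simps)
qed

text \<open>A vector in the kernel of the metric matrix is the component vector of a tangent vector that is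
orthogonal to all tangent vectors, so it vanishes.\<close>

lemma local_metric_chart:
  assumes "c \<in> A"
  shows "local_metric (chart_map c ` (chart_dom c \<inter> U)) (metric_matrix A g c)"
proof
  show "open (chart_map c ` (chart_dom c \<inter> U))"
    by (rule open_chart_image[OF assms open_U])
  show "smooth_on (chart_map c ` (chart_dom c \<inter> U)) (metric_matrix A g c)"
    using metric assms by (simp add: pseudo_riemannian_metric_on_def)
  fix y assume "y \<in> chart_map c ` (chart_dom c \<inter> U)"
  then obtain x where x: "x \<in> U" and c: "c \<in> charts_at A x" and y: "y = chart_map c x"
    using assms by (auto simp: charts_at_def)
  show sym: "metric_matrix A g c y $ i $ j = metric_matrix A g c y $ j $ i" for i j
    using metric_sym[OF x coord_vector_tangent[OF c] coord_vector_tangent[OF c]]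
    by (simp add: metric_matrix_def y chart_inv_map_at[OF c])
  have "u = 0" if "metric_matrix A g c y *v u = 0" for u
  proof -
    have row: "(\<Sum>i\<in>UNIV. metric_matrix A g c y $ j $ i * u $ i) = 0" for j
      using arg_cong[OF that, of "\<lambda>w. w $ j"] by (simp add: matrix_vector_mult_def)
    have col: "(\<Sum>i\<in>UNIV. metric_matrix A g c y $ i $ j * u $ i) = 0" for j
      using row[of j] by (simp only: sym[of _ j])
    have "g x (coord_vector A c x u) Y = 0" if Y: "Y \<in> tangent_space A x" for Y
    proof -
      have "g x (coord_vector A c x u) Y =
          (\<Sum>j\<in>UNIV. (\<Sum>i\<in>UNIV. metric_matrix A g c y $ i $ j * u $ i) * Y c $ j)"
        unfolding metric_in_chart[OF x c coord_vector_tangent[OF c] Y] y[symmetric]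
          sum_distrib_right
        by (subst sum.swap) (simp add: coord_vector_component[OF c])
      then show ?thesis by (simp add: col)
    qed
    from metric_nondegenerate[OF x coord_vector_tangent[OF c] this]
    show "u = 0" using coord_vector_component[OF c, of u] by simp
  qed
  then show "invertible (metric_matrix A g c y)"
    by (simp add: invertible_left_inverse matrix_left_invertible_ker)
qed

end


section \<open>Homogeneous pairs in charts\<close>

locale homogeneous_manifold = semi_riemannian A UNIV g
  for A :: "('a::{t2_space, second_countable_topology}, 'n::finite) chart set"
    and g :: "('a, 'n) metric_field" +
  fixes m :: "real \<Rightarrow> 'a \<Rightarrow> 'a" and f :: "'a \<Rightarrow> real" and \<alpha> :: real
  assumes action: "smooth_free_action A m"
    and pair: "homogeneous_pair A m g f \<alpha>"
begin

text \<open>The action in charts \<open>c\<close> and \<open>d\<close> is the map \<open>flow c d\<close> of \<open>(a, y)\<close>. Its derivative at \<open>a = 1\<close> in the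
direction \<open>(1, 0)\<close> is the generator, its derivative in the directions \<open>(0, u)\<close> is the tangent map of
the translations.\<close>

definition flow_dom :: "('a, 'n) chart \<Rightarrow> ('a, 'n) chart \<Rightarrow> (real \<times> (real ^ 'n)) set" where
  "flow_dom c d =
    {(a, y). a > 0 \<and> y \<in> chart_map c ` chart_dom c \<and> m a (chart_inv c y) \<in> chart_dom d}"

definition flow :: "('a, 'n) chart \<Rightarrow> ('a, 'n) chart \<Rightarrow> real \<times> (real ^ 'n) \<Rightarrow> real ^ 'n" where
  "flow c d = (\<lambda>(a, y). chart_map d (m a (chart_inv c y)))"

lemma smooth_flow: "c \<in> A \<Longrightarrow> d \<in> A \<Longrightarrow> smooth_on (flow_dom c d) (flow c d)"
  using action unfolding smooth_free_action_def flow_dom_def flow_def by blast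

lemma action_one: "m 1 x = x"
  using action by (simp add: smooth_free_action_def)

lemma open_flow_dom:
  assumes c: "c \<in> A" and d: "d \<in> A"
  shows "open (flow_dom c d)"
proof -
  let ?D = "{0<..} \<times> chart_map c ` chart_dom c"
  have "continuous_on ?D (\<lambda>z. (fst z, chart_inv c (snd z)))"
    by (intro continuous_intros continuous_on_compose2[OF continuous_on_chart_inv[OF c]]) auto
  moreover have "continuous_on ({0<..} \<times> UNIV) (\<lambda>(a, x). m a x)"
    using action by (simp add: smooth_free_action_def)
  ultimately have "continuous_on ?D ((\<lambda>(a, x). m a x) \<circ> (\<lambda>z. (fst z, chart_inv c (snd z))))"
    by (intro continuous_on_compose) (auto elim: continuous_on_subset)
  from continuous_open_preimage[OF this open_Times[OF open_greaterThan open_chart_range[OF c]]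
      open_chart_dom[OF d]]
  show ?thesis
    by (rule back_subst[where P = "open"]) (auto simp: flow_dom_def)
qed

lemma flow_has_derivative:
  assumes "c \<in> A" "d \<in> A" "z \<in> flow_dom c d"
  shows "(flow c d has_derivative frechet_derivative (flow c d) (at z)) (at z)"
  by (rule smooth_on_has_derivative[OF smooth_flow[OF assms(1,2)] assms(3)])

lemma flow_change_chart:
  assumes c: "c \<in> A" and d: "d \<in> charts_at A (m a (chart_inv c y))"
    and e: "e \<in> charts_at A (m a (chart_inv c y))"
    and ay: "a > 0" "y \<in> chart_map c ` chart_dom c"
  shows "frechet_derivative (flow c e) (at (a, y)) u =
    jacobian d e (m a (chart_inv c y)) (frechet_derivative (flow c d) (at (a, y)) u)"
proof -
  have dA: "d \<in> A" and eA: "e \<in> A" and z: "(a, y) \<in> flow_dom c d" "(a, y) \<in> flow_dom c e"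
    using charts_atD[OF d] charts_atD[OF e] ay by (auto simp: flow_dom_def)
  have "((\<lambda>z. (chart_map e \<circ> chart_inv d) (flow c d z)) has_derivative
     (\<lambda>u. jacobian d e (m a (chart_inv c y)) (frechet_derivative (flow c d) (at (a, y)) u)))
     (at (a, y))"
    by (rule has_derivative_compose[OF flow_has_derivative[OF c dA z(1)]])
      (use transition_has_derivative[OF d e] in \<open>simp add: flow_def o_def\<close>)
  then have "(flow c e has_derivative
     (\<lambda>u. jacobian d e (m a (chart_inv c y)) (frechet_derivative (flow c d) (at (a, y)) u)))
     (at (a, y))"
    by (rule has_derivative_transform_within_open[OF _ open_flow_dom[OF c dA] z(1)])
      (auto simp: flow_def flow_dom_def chart_inv_map[OF dA])
  from has_derivative_unique[OF flow_has_derivative[OF c eA z(2)] this] show ?thesis by meson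
qed

lemma generator_chart:
  assumes c: "c \<in> charts_at A x" and d: "d \<in> charts_at A x"
  shows "generator A m x d = frechet_derivative (flow c d) (at (1, chart_map c x)) (1, 0)"
proof -
  have cA: "c \<in> A" and dA: "d \<in> A" and z: "(1, chart_map c x) \<in> flow_dom c d"
    using charts_atD[OF c] charts_atD[OF d]
    by (auto simp: flow_dom_def action_one chart_inv_map_at[OF c])
  have "((\<lambda>t. (exp t, chart_map c x)) has_derivative (\<lambda>t. (t, 0))) (at (0::real))"
    by (auto intro!: derivative_eq_intros)
  from has_derivative_compose[OF this, of "flow c d"] flow_has_derivative[OF cA dA z]
  have D: "((\<lambda>t. flow c d (exp t, chart_map c x)) has_derivative
      (\<lambda>t. frechet_derivative (flow c d) (at (1, chart_map c x)) (t, 0))) (at 0)"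
    by simp
  have "frechet_derivative (flow c d) (at (1, chart_map c x)) (t, 0) =
      t *\<^sub>R frechet_derivative (flow c d) (at (1, chart_map c x)) (1, 0)" for t
    using linear_scale[OF has_derivative_linear[OF flow_has_derivative[OF cA dA z]], of t "(1, 0)"]
    by simp
  then have "(\<lambda>t. frechet_derivative (flow c d) (at (1, chart_map c x)) (t, 0)) =
      (\<lambda>t. t *\<^sub>R frechet_derivative (flow c d) (at (1, chart_map c x)) (1, 0))"
    by (rule ext)
  from D[unfolded this] have "((\<lambda>t. chart_map d (m (exp t) x)) has_vector_derivative
      frechet_derivative (flow c d) (at (1, chart_map c x)) (1, 0)) (at 0)"
    unfolding has_vector_derivative_def flow_def by (simp add: chart_inv_map_at[OF c])
  then show ?thesis
    using d by (simp add: generator_def velocity_def action_one vector_derivative_at)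
qed

lemma generator_tangent: "generator A m x \<in> tangent_space A x"
proof -
  have "generator A m x d = jacobian c d x (generator A m x c)"
    if "c \<in> charts_at A x" "d \<in> charts_at A x" for c d
    using flow_change_chart[of c c 1 "chart_map c x" d] that charts_atD[OF that(1)]
    by (simp add: generator_chart[OF that(1)] chart_inv_map_at action_one)
  then show ?thesis
    by (rule tangent_spaceI) (simp_all add: generator_def velocity_def action_one)
qed

lemma tangent_map_chart:
  assumes a: "a > 0" and c: "c \<in> charts_at A x" and d: "d \<in> charts_at A (m a x)"
    and X: "X \<in> tangent_space A x"
  shows "tangent_map A (m a) x X d =
    frechet_derivative (flow c d) (at (a, chart_map c x)) (0, X c)"
proof -
  define e where "e = some_chart A x"
  have e: "e \<in> charts_at A x" by (simp add: e_def some_chart_at)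
  have cA: "c \<in> A" and dA: "d \<in> A" and z: "(a, chart_map c x) \<in> flow_dom c d"
    using charts_atD[OF c] charts_atD[OF d] a by (auto simp: flow_dom_def chart_inv_map_at[OF c])
  have "((\<lambda>y. (a, y)) has_derivative (\<lambda>u. (0, u))) (at (chart_map c x))"
    by (auto intro!: derivative_eq_intros)
  from has_derivative_compose[OF this flow_has_derivative[OF cA dA z]]
  have "(((chart_map d \<circ> m a) \<circ> chart_inv c) has_derivative
      (\<lambda>u. frechet_derivative (flow c d) (at (a, chart_map c x)) (0, u))) (at (chart_map c x))"
    by (simp add: flow_def o_def)
  from derivative_change_chart[OF e c this]
  show ?thesis
    using d tangent_change_chart[OF X e c]
    by (simp add: tangent_map_def Let_def flip: e_def frechet_derivative_at)
qed

lemma tangent_map_tangent: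
  assumes a: "a > 0" and X: "X \<in> tangent_space A x"
  shows "tangent_map A (m a) x X \<in> tangent_space A (m a x)"
proof -
  define c where "c = some_chart A x"
  have c: "c \<in> charts_at A x" by (simp add: c_def some_chart_at)
  have "tangent_map A (m a) x X e = jacobian d e (m a x) (tangent_map A (m a) x X d)"
    if "d \<in> charts_at A (m a x)" "e \<in> charts_at A (m a x)" for d e
    using flow_change_chart[of c d a "chart_map c x" e] that charts_atD[OF c] a
    by (simp add: tangent_map_chart[OF a c _ X] chart_inv_map_at[OF c])
  then show ?thesis
    by (rule tangent_spaceI) (simp_all add: tangent_map_def Let_def)
qed

definition chart_field :: "('a, 'n) chart \<Rightarrow> real ^ 'n \<Rightarrow> real ^ 'n" where
  "chart_field c y = generator A m (chart_inv c y) c"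

lemma smooth_f: "c \<in> A \<Longrightarrow> smooth_on (chart_map c ` chart_dom c) (f \<circ> chart_inv c)"
  using pair by (simp add: homogeneous_pair_def smooth_function_def)

context
  fixes c y
  assumes c: "c \<in> A" and y: "y \<in> chart_map c ` chart_dom c"
begin

lemma one_in_flow_dom: "(1, y) \<in> flow_dom c c"
  using chart_map_inv[OF c y] y by (simp add: flow_dom_def action_one)

lemma chart_field_eq: "chart_field c y = frechet_derivative (flow c c) (at (1, y)) (1, 0)"
  using generator_chart[OF charts_at_chart_inv[OF c y] charts_at_chart_inv[OF c y]]
  by (simp add: chart_field_def chart_map_inv[OF c y])

lemma flow_one: "flow c c (1, y) = y"
  by (simp add: flow_def action_one chart_map_inv[OF c y])

lemma flow_orbit_derivative:
  "((\<lambda>a. flow c c (a, y)) has_derivative (\<lambda>t. t *\<^sub>R chart_field c y)) (at 1)"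
proof -
  have "((\<lambda>a. (a, y)) has_derivative (\<lambda>t. (t, 0))) (at (1::real))"
    by (auto intro!: derivative_eq_intros)
  from has_derivative_compose[OF this flow_has_derivative[OF c c one_in_flow_dom]]
  have "((\<lambda>a. flow c c (a, y)) has_derivative
    (\<lambda>t. frechet_derivative (flow c c) (at (1, y)) (t, 0))) (at 1)" .
  moreover have "frechet_derivative (flow c c) (at (1, y)) (t, 0) = t *\<^sub>R chart_field c y" for t
    using linear_scale[OF has_derivative_linear[OF flow_has_derivative[OF c c one_in_flow_dom]],
        of t "(1, 0)"]
    by (simp add: chart_field_eq)
  ultimately show ?thesis by (rule has_derivative_eq_rhs[OF _ ext])
qed

lemma derivative_along_flow:
  assumes "h differentiable (at y)"
  shows "((\<lambda>a. h (flow c c (a, y))) has_real_derivative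
    (\<Sum>q\<in>UNIV. partial q h y * chart_field c y $ q)) (at 1)"
proof -
  have h: "(h has_derivative frechet_derivative h (at y)) (at (flow c c (1, y)))"
    using assms by (simp add: flow_one frechet_derivative_works)
  have "frechet_derivative h (at y) (t *\<^sub>R chart_field c y) =
      (\<Sum>q\<in>UNIV. partial q h y * chart_field c y $ q) * t" for t
    by (simp add: linear_scale[OF linear_frechet_derivative[OF assms]]
        frechet_derivative_partials[OF assms] sum_distrib_left sum_distrib_right mult_ac)
  from has_derivative_compose[OF flow_orbit_derivative h, unfolded this] show ?thesis
    unfolding has_field_derivative_def .
qed

lemma flow_dom_slice: "open {a. (a, y) \<in> flow_dom c c}" "1 \<in> {a. (a, y) \<in> flow_dom c c}"
proof -
  have "continuous_on UNIV (\<lambda>a::real. (a, y))" by (intro continuous_intros)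
  from open_vimage[OF open_flow_dom[OF c c] this]
  show "open {a. (a, y) \<in> flow_dom c c}" by (simp add: vimage_def)
qed (use one_in_flow_dom in simp)

lemma flow_fibre_derivative_one: "frechet_derivative (flow c c) (at (1, y)) (0, u) = u"
proof -
  have "((\<lambda>z. (1::real, z)) has_derivative (\<lambda>u. (0, u))) (at y)"
    by (auto intro!: derivative_eq_intros)
  from has_derivative_compose[OF this flow_has_derivative[OF c c one_in_flow_dom]]
  have "((\<lambda>z. flow c c (1, z)) has_derivative
    (\<lambda>u. frechet_derivative (flow c c) (at (1, y)) (0, u))) (at y)" .
  then have "((\<lambda>z. z) has_derivative
    (\<lambda>u. frechet_derivative (flow c c) (at (1, y)) (0, u))) (at y)"
    by (rule has_derivative_transform_within_open[OF _ open_chart_range[OF c] y])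
      (simp add: flow_def action_one chart_map_inv[OF c])
  from has_derivative_unique[OF this has_derivative_ident] show ?thesis by meson
qed

end

text \<open>Interchanging the derivatives in \<open>a\<close> and in \<open>y\<close>: the tangent map of the translation by \<open>a\<close> has the
derivative \<open>\<partial>p\<close> at \<open>a = 1\<close>, where \<open>p\<close> is the generator.\<close>

lemma flow_fibre_derivative:
  assumes c: "c \<in> A" and y: "y \<in> chart_map c ` chart_dom c"
  shows "((\<lambda>a. frechet_derivative (flow c c) (at (a, y)) (0, axis i 1) $ k) has_real_derivative
    partial i (\<lambda>z. chart_field c z $ k) y) (at 1)"
proof -
  note one = one_in_flow_dom[OF c y]
  note open_dom = open_flow_dom[OF c c]
  let ?h = "\<lambda>z. flow c c z $ k"
  let ?D = "\<lambda>u z. frechet_derivative ?h (at z) u"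
  have h: "smooth_on (flow_dom c c) ?h"
    by (rule smooth_on_vec_nth[OF open_dom smooth_flow[OF c c]])
  have comp: "?D u z = frechet_derivative (flow c c) (at z) u $ k" if "z \<in> flow_dom c c" for u z
    using fun_cong[OF frechet_derivative_at[OF bounded_linear.has_derivative[OF
          bounded_linear_vec_nth flow_has_derivative[OF c c that], of k]], of u] by simp
  have D: "(?D u has_derivative frechet_derivative (?D u) (at (1, y))) (at (1, y))" for u
    by (rule smooth_on_has_derivative[OF smooth_on_frechet[OF h] one])
  have "((\<lambda>z. (1::real, z)) has_derivative (\<lambda>u. (0, u))) (at y)"
    by (auto intro!: derivative_eq_intros)
  from has_derivative_compose[OF this D[of "(1, 0)"]]
  have "((\<lambda>z. ?D (1, 0) (1, z)) has_derivative
      (\<lambda>u. frechet_derivative (?D (1, 0)) (at (1, y)) (0, u))) (at y)" .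
  then have "((\<lambda>z. chart_field c z $ k) has_derivative
      (\<lambda>u. frechet_derivative (?D (1, 0)) (at (1, y)) (0, u))) (at y)"
    by (rule has_derivative_transform_within_open[OF _ open_chart_range[OF c] y])
      (simp add: comp one_in_flow_dom[OF c] chart_field_eq[OF c])
  then have "partial i (\<lambda>z. chart_field c z $ k) y =
      frechet_derivative (?D (1, 0)) (at (1, y)) (0, axis i 1)"
    by (rule partial_eqI)
  also have "\<dots> = frechet_derivative (?D (0, axis i 1)) (at (1, y)) (1, 0)"
    using mixed_second_derivatives_commute[OF open_dom _ one] h unfolding smooth_on_def by blast
  finally have p: "partial i (\<lambda>z. chart_field c z $ k) y = \<dots>" .
  have "((\<lambda>a. (a, y)) has_derivative (\<lambda>t. (t, 0))) (at (1::real))"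
    by (auto intro!: derivative_eq_intros)
  from has_derivative_compose[OF this D[of "(0, axis i 1)"]]
  have "((\<lambda>a. ?D (0, axis i 1) (a, y)) has_derivative
      (\<lambda>t. frechet_derivative (?D (0, axis i 1)) (at (1, y)) (t, 0))) (at 1)" .
  moreover have "frechet_derivative (?D (0, axis i 1)) (at (1, y)) (t, 0) =
      partial i (\<lambda>z. chart_field c z $ k) y * t" for t
    unfolding p using linear_scale[OF has_derivative_linear[OF D[of "(0, axis i 1)"]], of t "(1, 0)"]
    by (simp add: mult.commute)
  ultimately have "((\<lambda>a. ?D (0, axis i 1) (a, y)) has_real_derivative
      partial i (\<lambda>z. chart_field c z $ k) y) (at 1)"
    unfolding has_field_derivative_def by (rule has_derivative_eq_rhs[OF _ ext])
  then show ?thesis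
    by (rule has_field_derivative_transform_within_open[OF _ flow_dom_slice[OF c y]])
      (simp add: comp)
qed

lemma degree_nonzero: "\<alpha> \<noteq> 0"
  using pair by (simp add: homogeneous_pair_def)

lemma f_pos: "f x > 0"
  using pair by (simp add: homogeneous_pair_def)

lemma f_homogeneous: "a > 0 \<Longrightarrow> f (m a x) = a powr \<alpha> * f x"
  using pair by (simp add: homogeneous_pair_def)

lemma g_homogeneous:
  "a > 0 \<Longrightarrow> X \<in> tangent_space A x \<Longrightarrow> Y \<in> tangent_space A x \<Longrightarrow>
    g (m a x) (tangent_map A (m a) x X) (tangent_map A (m a) x Y) = a powr \<alpha> * g x X Y"
  using pair by (simp add: homogeneous_pair_def)

lemma g_generator: "X \<in> tangent_space A x \<Longrightarrow> g x (generator A m x) X = differential A f x X"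
  using pair by (simp add: homogeneous_pair_def)

lemma powr_derivative_one: "((\<lambda>a. a powr \<alpha> * r) has_real_derivative \<alpha> * r) (at 1)"
  by (auto intro!: derivative_eq_intros)

text \<open>Each homogeneity condition is an identity in \<open>a\<close>; its derivative at \<open>a = 1\<close> is the corresponding
infinitesimal condition. For the metric, the identity is
\<open>\<Sum>\<^sub>k\<^sub>l G\<^sub>k\<^sub>l(flow) B\<^sub>i\<^sub>k B\<^sub>j\<^sub>l = a powr \<alpha> * G\<^sub>i\<^sub>j\<close> with \<open>B\<close> the matrix of the tangent map, and the product rule
produces the three terms of the Lie derivative.\<close>

lemma homogeneous_local_metric_chart:
  assumes c: "c \<in> A"
  shows "homogeneous_local_metric (chart_map c ` chart_dom c) (metric_matrix A g c)
    (chart_field c) (f \<circ> chart_inv c) \<alpha>"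
proof -
  let ?S = "chart_map c ` chart_dom c" and ?G = "metric_matrix A g c" and ?p = "chart_field c"
    and ?F = "f \<circ> chart_inv c"
  interpret local_metric ?S ?G
    using local_metric_chart[OF c] by simp
  show ?thesis
  proof
    show "\<alpha> \<noteq> 0" by (rule degree_nonzero)
    show "smooth_on ?S ?F" by (rule smooth_f[OF c])
    fix y assume y: "y \<in> ?S"
    define x where "x = chart_inv c y"
    have cx: "c \<in> charts_at A x" and xy: "chart_map c x = y"
      using charts_at_chart_inv[OF c y] chart_map_inv[OF c y] by (simp_all add: x_def)
    let ?E = "\<lambda>i. coord_vector A c x (axis i 1)"
    have E: "?E i \<in> tangent_space A x" "?E i c = axis i 1" for i
      using coord_vector_tangent[OF cx] coord_vector_component[OF cx] by blast+
    have axis: "axis i 1 $ l = (if l = i then 1 else (0::real))" for i l :: 'n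
      by (simp add: axis_def)
    have dF: "?F differentiable (at y)"
      by (rule smooth_on_differentiable[OF smooth_f[OF c] y])
    show "(\<Sum>k\<in>UNIV. ?G y $ i $ k * ?p y $ k) = partial i ?F y" for i
    proof -
      have "partial i ?F y = g x (generator A m x) (?E i)"
        using differential_chart[OF _ cx E(1)[of i], of f] dF
        by (simp add: g_generator E xy partial_def)
      also have "\<dots> = (\<Sum>k\<in>UNIV. ?G y $ k $ i * ?p y $ k)"
        by (simp add: metric_in_chart[OF _ cx generator_tangent E(1)] xy E(2) axis
            chart_field_def x_def[symmetric] if_distrib[of "\<lambda>t. _ * t"] cong: if_cong)
      finally show ?thesis by (simp add: sym[OF y, of i])
    qed
    show "(\<Sum>k\<in>UNIV. partial k ?F y * ?p y $ k) = \<alpha> * ?F y"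
    proof (rule DERIV_unique[OF derivative_along_flow[OF c y dF]])
      show "((\<lambda>a. ?F (flow c c (a, y))) has_real_derivative \<alpha> * ?F y) (at 1)"
        by (rule has_field_derivative_transform_within_open[OF powr_derivative_one
              flow_dom_slice[OF c y]])
          (auto simp: flow_dom_def flow_def chart_inv_map[OF c] f_homogeneous)
    qed
    fix i j
    define B where "B i k a = frechet_derivative (flow c c) (at (a, y)) (0, axis i 1) $ k" for i k a
    have dB: "(B i k has_real_derivative partial i (\<lambda>z. ?p z $ k) y) (at 1)" for i k
      unfolding B_def by (rule flow_fibre_derivative[OF c y])
    have B1: "B i k 1 = (if k = i then 1 else 0)" for i k
      by (simp add: B_def flow_fibre_derivative_one[OF c y] axis_def)
    have dG: "((\<lambda>a. ?G (flow c c (a, y)) $ k $ l) has_real_derivative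
        (\<Sum>q\<in>UNIV. partial q (\<lambda>z. ?G z $ k $ l) y * ?p y $ q)) (at 1)" for k l
      by (rule derivative_along_flow[OF c y diff_entry[OF y]])
    have pullback: "a powr \<alpha> * ?G y $ i $ j =
        (\<Sum>k\<in>UNIV. \<Sum>l\<in>UNIV. ?G (flow c c (a, y)) $ k $ l * B i k a * B j l a)"
      if "a \<in> {a. (a, y) \<in> flow_dom c c}" for a
    proof -
      have a: "a > 0" and d: "c \<in> charts_at A (m a x)"
        using that c by (auto simp: flow_dom_def x_def charts_at_def)
      have flow: "chart_map c (m a x) = flow c c (a, y)" by (simp add: flow_def x_def)
      have "a powr \<alpha> * ?G y $ i $ j =
          g (m a x) (tangent_map A (m a) x (?E i)) (tangent_map A (m a) x (?E j))"
        unfolding g_homogeneous[OF a E(1) E(1)] by (simp add: metric_matrix_def x_def)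
      also have "\<dots> = (\<Sum>k\<in>UNIV. \<Sum>l\<in>UNIV. ?G (flow c c (a, y)) $ k $ l * B i k a * B j l a)"
        unfolding metric_in_chart[OF UNIV_I d tangent_map_tangent[OF a E(1)]
            tangent_map_tangent[OF a E(1)]] tangent_map_chart[OF a cx d E(1)] E(2) xy B_def flow ..
      finally show ?thesis .
    qed
    have "((\<lambda>a. \<Sum>k\<in>UNIV. \<Sum>l\<in>UNIV. ?G (flow c c (a, y)) $ k $ l * B i k a * B j l a)
        has_real_derivative \<alpha> * ?G y $ i $ j) (at 1)"
      by (rule has_field_derivative_transform_within_open[OF powr_derivative_one
            flow_dom_slice[OF c y] pullback])
    moreover have "((\<lambda>a. \<Sum>k\<in>UNIV. \<Sum>l\<in>UNIV. ?G (flow c c (a, y)) $ k $ l * B i k a * B j l a)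
        has_real_derivative (\<Sum>k\<in>UNIV. \<Sum>l\<in>UNIV.
          ((\<Sum>q\<in>UNIV. partial q (\<lambda>z. ?G z $ k $ l) y * ?p y $ q) * B i k 1
            + partial i (\<lambda>z. ?p z $ k) y * ?G (flow c c (1, y)) $ k $ l) * B j l 1
          + partial j (\<lambda>z. ?p z $ l) y * (?G (flow c c (1, y)) $ k $ l * B i k 1))) (at 1)"
      by (intro DERIV_sum DERIV_mult dG dB)
    ultimately have "\<alpha> * ?G y $ i $ j = (\<Sum>k\<in>UNIV. \<Sum>l\<in>UNIV.
          ((\<Sum>q\<in>UNIV. partial q (\<lambda>z. ?G z $ k $ l) y * ?p y $ q) * B i k 1
            + partial i (\<lambda>z. ?p z $ k) y * ?G (flow c c (1, y)) $ k $ l) * B j l 1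
          + partial j (\<lambda>z. ?p z $ l) y * (?G (flow c c (1, y)) $ k $ l * B i k 1))"
      by (rule DERIV_unique)
    moreover have "(\<Sum>l\<in>UNIV. if P then t l else 0) = (if P then sum t UNIV else 0)"
      for P and t :: "'n \<Rightarrow> real"
      by simp
    ultimately have "\<alpha> * ?G y $ i $ j = (\<Sum>q\<in>UNIV. partial q (\<lambda>z. ?G z $ i $ j) y * ?p y $ q)
        + (\<Sum>k\<in>UNIV. partial i (\<lambda>z. ?p z $ k) y * ?G y $ k $ j)
        + (\<Sum>l\<in>UNIV. partial j (\<lambda>z. ?p z $ l) y * ?G y $ i $ l)"
      by (simp add: B1 flow_one[OF c y] sum.distrib if_distrib[of "\<lambda>t. _ * t"] distrib_right
          cong: if_cong)
    then show "(\<Sum>k\<in>UNIV. partial k (\<lambda>z. ?G z $ i $ j) y * ?p y $ k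
         + ?G y $ k $ j * partial i (\<lambda>z. ?p z $ k) y
         + ?G y $ i $ k * partial j (\<lambda>z. ?p z $ k) y) = \<alpha> * ?G y $ i $ j"
      by (simp add: sum.distrib mult.commute)
  qed
qed

end


section \<open>Curvature of the rescaled metrics\<close>

lemma (in semi_riemannian) pseudo_riemannian_rescaled:
  assumes "open V" and "V \<subseteq> U" and nz: "\<And>x. x \<in> V \<Longrightarrow> \<phi> x \<noteq> 0"
    and smooth: "\<And>c. c \<in> A \<Longrightarrow> smooth_on (chart_map c ` (chart_dom c \<inter> V)) (\<phi> \<circ> chart_inv c)"
  shows "pseudo_riemannian_metric_on A V (\<lambda>x X Y. \<phi> x * g x X Y)"
  unfolding pseudo_riemannian_metric_on_def
proof (intro conjI ballI allI impI \<open>open V\<close>)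
  have V: "x \<in> U" if "x \<in> V" for x using assms(2) that by blast
  fix x X assume x: "x \<in> V" and X: "X \<in> tangent_space A x"
  show "\<phi> x * g x X Y = \<phi> x * g x Y X" if "Y \<in> tangent_space A x" for Y
    by (simp add: metric_sym[OF V[OF x] X that])
  show "\<phi> x * g x (\<lambda>c. a *\<^sub>R X c + b *\<^sub>R Y c) Z = a * (\<phi> x * g x X Z) + b * (\<phi> x * g x Y Z)"
    if "Y \<in> tangent_space A x" "Z \<in> tangent_space A x" for Y Z a b
    by (simp add: metric_linear[OF V[OF x] X that] algebra_simps)
  show "X = (\<lambda>_. 0)" if "\<forall>Y\<in>tangent_space A x. \<phi> x * g x X Y = 0"
    using that nz[OF x] by (intro metric_nondegenerate[OF V[OF x] X]) simp
next
  fix c assume c: "c \<in> A"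
  have "metric_matrix A (\<lambda>x X Y. \<phi> x * g x X Y) c =
      (\<lambda>y. (\<phi> \<circ> chart_inv c) y *\<^sub>R metric_matrix A g c y)"
    by (simp add: fun_eq_iff vec_eq_iff metric_matrix_def)
  moreover have "smooth_on (chart_map c ` (chart_dom c \<inter> V)) (metric_matrix A g c)"
    by (rule smooth_on_subset[OF local_metric.smooth_G[OF local_metric_chart[OF c]]])
      (use assms(2) in auto)
  ultimately show "smooth_on (chart_map c ` (chart_dom c \<inter> V))
      (metric_matrix A (\<lambda>x X Y. \<phi> x * g x X Y) c)"
    using smooth_on_scaleR[OF open_chart_image[OF c \<open>open V\<close>] smooth[OF c]] by simp
qed

lemma (in homogeneous_manifold) open_f_preimage:
  assumes "open T"
  shows "open {x. f x \<in> T}"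
proof -
  have "continuous_on (chart_dom c) f" if c: "c \<in> A" for c
  proof -
    have "continuous_on (chart_map c ` chart_dom c) (f \<circ> chart_inv c)"
      using smooth_f[OF c] Ck_on.simps(1) unfolding smooth_on_def by blast
    from continuous_on_compose[OF continuous_on_chart_map[OF c] this]
    show ?thesis
      by (rule continuous_on_eq) (simp add: chart_inv_map[OF c])
  qed
  then have "continuous_on (\<Union>c\<in>A. chart_dom c) f"
    by (intro continuous_on_open_UN open_chart_dom)
  moreover have "(\<Union>c\<in>A. chart_dom c) = UNIV"
    using atlas by (simp add: smooth_atlas_def)
  ultimately show ?thesis
    using open_vimage[OF assms] by (simp add: vimage_def)
qed

lemma (in homogeneous_manifold) pseudo_riemannian_profile:
  assumes prof: "curvature_profile \<alpha> C T v h"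
  shows "pseudo_riemannian_metric_on A {x. f x \<in> T} (\<lambda>x X Y. v (f x) * g x X Y)"
proof (rule pseudo_riemannian_rescaled)
  have "open T" using prof by (simp add: curvature_profile_def)
  then show open_V: "open {x. f x \<in> T}" by (rule open_f_preimage)
  show "v (f x) \<noteq> 0" if "x \<in> {x. f x \<in> T}" for x
    using prof that by (simp add: curvature_profile_def)
  fix c assume c: "c \<in> A"
  let ?S = "chart_map c ` (chart_dom c \<inter> {x. f x \<in> T})"
  have FT: "(f \<circ> chart_inv c) ` ?S \<subseteq> T" by (auto simp: chart_inv_map[OF c])
  have smooth_F: "smooth_on ?S (f \<circ> chart_inv c)"
    by (rule smooth_on_subset[OF smooth_f[OF c]]) auto
  from smooth_on_compose_real[OF open_chart_image[OF c open_V] FT curvature_profile_smooth(1)[OF prof]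
      smooth_F]
  show "smooth_on ?S ((\<lambda>x. v (f x)) \<circ> chart_inv c)" by (simp only: o_def)
qed simp

text \<open>The whole tensor is computed, and not only the sectional curvature, because flatness (the case
\<open>C = 0\<close>) requires all of it to vanish.\<close>

lemma rescaled_surface_curvature:
  fixes A :: "('a::{t2_space, second_countable_topology}, 2) chart set"
  assumes "homogeneous_manifold A g m f \<alpha>" and prof: "curvature_profile \<alpha> C T v h"
    and "f x \<in> T" and c: "c \<in> charts_at A x"
    and X: "X \<in> tangent_space A x" and Y: "Y \<in> tangent_space A x" and Z: "Z \<in> tangent_space A x"
  shows "curvature A (\<lambda>x X Y. v (f x) * g x X Y) c x X Y Z =
    (\<lambda>d. (C * (v (f x) * g x Y Z)) *\<^sub>R X d + (- C * (v (f x) * g x X Z)) *\<^sub>R Y d)"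
  unfolding curvature_def
proof (rule smooth_manifold.coord_vector_tangent_eq)
  interpret homogeneous_manifold A g m f \<alpha> by fact
  show "smooth_manifold A" ..
  let ?g = "\<lambda>x X Y. v (f x) * g x X Y"
  let ?R = "\<lambda>d. (C * ?g x Y Z) *\<^sub>R X d + (- C * ?g x X Z) *\<^sub>R Y d"
  show "?R \<in> tangent_space A x" by (rule tangent_linear_combination[OF X Y])
  show "c \<in> charts_at A x" by (rule c)
  have cA: "c \<in> A" and x: "x \<in> chart_dom c" using charts_atD[OF c] .
  let ?G = "metric_matrix A g c" and ?F = "f \<circ> chart_inv c" and ?y = "chart_map c x"
  let ?S = "chart_map c ` (chart_dom c \<inter> {x. f x \<in> T})"
  have hom: "homogeneous_local_metric ?S ?G (chart_field c) ?F \<alpha>"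
  proof (rule homogeneous_local_metric.subset[OF homogeneous_local_metric_chart[OF cA]])
    show "open ?S"
      using prof by (intro open_chart_image[OF cA] open_f_preimage) (simp add: curvature_profile_def)
  qed auto
  have G: "metric_matrix A ?g c = (\<lambda>y. v (?F y) *\<^sub>R ?G y)"
    by (simp add: fun_eq_iff vec_eq_iff metric_matrix_def)
  have "?F ` ?S \<subseteq> T" by (auto simp: chart_inv_map[OF cA])
  moreover have "?y \<in> ?S" using x \<open>f x \<in> T\<close> by blast
  ultimately have R: "riemann (metric_matrix A ?g c) l k i j ?y =
      C * ((if l = i then v (f x) * ?G ?y $ j $ k else 0)
        - (if l = j then v (f x) * ?G ?y $ i $ k else 0))" for l k i j
    using rescaled_surface_riemann[OF hom prof, of ?y l k i j] unfolding G
    by (simp add: chart_inv_map_at[OF c])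
  show "?R c = (\<chi> l. \<Sum>k\<in>UNIV. \<Sum>i\<in>UNIV. \<Sum>j\<in>UNIV.
      riemann (metric_matrix A ?g c) l k i j ?y * X c $ i * Y c $ j * Z c $ k)"
    unfolding R vec_eq_iff forall_2 metric_in_chart[OF UNIV_I c Y Z] metric_in_chart[OF UNIV_I c X Z]
    by (simp add: sum_2 algebra_simps)
qed

lemma profile_constant_curvature:
  fixes A :: "('a::{t2_space, second_countable_topology}, 2) chart set"
  assumes hom: "homogeneous_manifold A g m f \<alpha>" and prof: "curvature_profile \<alpha> C T v h"
  shows "has_constant_sectional_curvature_on A {x. f x \<in> T} (\<lambda>x X Y. v (f x) * g x X Y) C"
proof -
  interpret homogeneous_manifold A g m f \<alpha> by fact
  let ?g = "\<lambda>x X Y. v (f x) * g x X Y"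
  note metric' = pseudo_riemannian_profile[OF prof]
  have "sectional_curvature A ?g c x X Y = C"
    if x: "f x \<in> T" and c: "c \<in> charts_at A x"
      and X: "X \<in> tangent_space A x" and Y: "Y \<in> tangent_space A x"
      and gram: "gram_det ?g x X Y \<noteq> 0" for x c X Y
  proof -
    have "?g x (curvature A ?g c x X Y Y) X = C * ?g x Y Y * ?g x X X + - C * ?g x X Y * ?g x Y X"
      unfolding rescaled_surface_curvature[OF hom prof x c X Y Y] metric_linear[OF UNIV_I X Y X]
      by (simp add: algebra_simps)
    also have "\<dots> = C * gram_det ?g x X Y"
      by (simp add: gram_det_def metric_sym[OF UNIV_I Y X] power2_eq_square algebra_simps)
    finally show ?thesis using gram by (simp add: sectional_curvature_def)
  qed
  with metric' show ?thesis by (simp add: has_constant_sectional_curvature_on_def)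
qed

theorem corollary3p17:
  fixes A :: "('a::{t2_space, second_countable_topology}, 2) chart set"
    and m :: "real \<Rightarrow> 'a \<Rightarrow> 'a"
    and g :: "('a, 2) metric_field"
    and f :: "'a \<Rightarrow> real"
    and \<alpha> :: real
  assumes "smooth_atlas A"
    and "smooth_free_action A m"
    and "homogeneous_pair A m g f \<alpha>"
  shows "(\<forall>C C1 C2 \<sigma> v.
            (C / \<alpha>, C1, C2) \<in> Delta1 \<union> Delta2 \<union> Delta3 \<longrightarrow>
            \<sigma> \<in> {1, -1} \<longrightarrow>
            (\<forall>r\<in>w_domain (C / \<alpha>) C1 C2. v r = 1 / r * w \<sigma> (C / \<alpha>) C1 C2 r) \<longrightarrow>
            has_constant_sectional_curvature_on A {x. f x \<in> w_domain (C / \<alpha>) C1 C2}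
              (\<lambda>x X Y. v (f x) * g x X Y) C)
       \<and> (\<forall>\<beta>. flat_on A UNIV (\<lambda>x X Y. f x powr \<beta> * g x X Y))"
proof (intro conjI allI impI)
  have hom: "homogeneous_manifold A g m f \<alpha>"
    using assms by unfold_locales (simp_all add: homogeneous_pair_def)
  then interpret homogeneous_manifold A g m f \<alpha> .
  show "has_constant_sectional_curvature_on A {x. f x \<in> w_domain (C / \<alpha>) C1 C2}
      (\<lambda>x X Y. v (f x) * g x X Y) C"
    if "(C / \<alpha>, C1, C2) \<in> Delta1 \<union> Delta2 \<union> Delta3" "\<sigma> \<in> {1, -1}"
      "\<forall>r\<in>w_domain (C / \<alpha>) C1 C2. v r = 1 / r * w \<sigma> (C / \<alpha>) C1 C2 r" for C C1 C2 \<sigma> v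
  proof (rule w_curvature_profile[OF degree_nonzero that(1,2)])
    show "v r = 1 / r * w \<sigma> (C / \<alpha>) C1 C2 r" if "r \<in> w_domain (C / \<alpha>) C1 C2" for r
      using that \<open>\<forall>r\<in>w_domain (C / \<alpha>) C1 C2. _ r\<close> by blast
  qed (rule profile_constant_curvature[OF hom])
  show "flat_on A UNIV (\<lambda>x X Y. f x powr \<beta> * g x X Y)" for \<beta>
  proof -
    note prof = powr_curvature_profile[OF degree_nonzero, of \<beta>]
    have "pseudo_riemannian_metric_on A UNIV (\<lambda>x X Y. f x powr \<beta> * g x X Y)"
      using pseudo_riemannian_profile[OF prof] f_pos by simp
    then show ?thesis
      using rescaled_surface_curvature[OF hom prof] f_pos by (simp add: flat_on_def)
  qed
qed

end
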